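(* Let $(\mathcal{D},+)$ be a nonempty abelian semigroup, and denote by $S$ the antipode of the Hopf algebra $(\mathcal{H}_{\mathcal{G}(\mathcal{D})},m,\Delta)$ of $\mathcal{D}$-decorated graphs. For any $\mathcal{D}$-decorated graph $G$: $$S(G)=\sum_{\sim\triangleleft G}(-1)^{cl(\sim)}\,\sharp\{\text{acyclic orientations of }G/\sim\}\;G|\sim.$$
   Context: A graph is a pair $G=(V(G),E(G))$ with $V(G)$ a finite set and $E(G)$ a set of $2$-element subsets of $V(G)$. The empty graph is denoted $1$ and is considered as non connected. A $\mathcal{D}$-decorated graph is a graph $G$ with a map $d_G:V(G)\to\mathcal{D}$; such objects are considered up to decoration-preserving isomorphism. For $I\subseteq V(G)$, $G_{|I}$ is the induced subgraph on $I$, decorated by restriction. For an equivalence relation $\sim$ on $V(G)$: $cl(\sim)$ is its number of classes; $G/\sim$ is the graph with vertex set $V(G)/\sim$ and with an edge between two distinct classes if and only if some edge of $G$ joins an element of one to an element of the other, decorated by $d_{G/\sim}(c)=\sum_{x\in c}d_G(x)$; $G|\sim$ is the graph with $V(G|\sim)=V(G)$, $E(G|\sim)=\{\{x,y\}\in E(G):x\sim y\}$, decorated by $d_G$; one writes $\sim\triangleleft G$ if $G_{|c}$ is connected for every class $c$ of $\sim$. $\mathcal{H}_{\mathcal{G}(\mathcal{D})}$ is the $\mathbb{Q}$-vector space with basis the isoclasses of $\mathcal{D}$-decorated graphs; $m$ is the disjoint union product and $\Delta(G)=\sum_{V(G)=I\sqcup J}G_{|I}\otimes G_{|J}$. $(\mathcal{H}_{\mathcal{G}(\mathcal{D})},m,\Delta)$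 is a Hopf algebra. An acyclic orientation of a graph is a choice of direction for each edge producing no oriented cycle. *)

theory Defs
  imports Complex_Main "HOL-Library.Poly_Mapping"
begin

section \<open>Decorated graphs\<close>

text \<open>
  Only the values of \<open>dec\<close> on the vertices are meaningful. Graphs are only ever compared up to
  isomorphism, which ignores the other values.
\<close>

record ('v, 'd) dgraph =
  verts :: "'v set"
  edges :: "'v set set"
  dec :: "'v \<Rightarrow> 'd"

definition is_graph :: "('v, 'd) dgraph \<Rightarrow> bool" where
  "is_graph G \<longleftrightarrow> finite (verts G) \<and> (\<forall>e\<in>edges G. e \<subseteq> verts G \<and> card e = 2)"

definition graph_iso :: "('v \<Rightarrow> 'w) \<Rightarrow> ('v, 'd) dgraph \<Rightarrow> ('w, 'd) dgraph \<Rightarrow> bool" where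
  "graph_iso \<phi> G H \<longleftrightarrow>
     bij_betw \<phi> (verts G) (verts H) \<and>
     (\<forall>x\<in>verts G. \<forall>y\<in>verts G. {x, y} \<in> edges G \<longleftrightarrow> {\<phi> x, \<phi> y} \<in> edges H) \<and>
     (\<forall>x\<in>verts G. dec H (\<phi> x) = dec G x)"

definition isomorphic :: "('v, 'd) dgraph \<Rightarrow> ('w, 'd) dgraph \<Rightarrow> bool" where
  "isomorphic G H \<longleftrightarrow> (\<exists>\<phi>. graph_iso \<phi> G H)"

definition empty_graph :: "('v, 'd) dgraph" where
  "empty_graph = \<lparr>verts = {}, edges = {}, dec = (\<lambda>_. undefined)\<rparr>"

definition disjoint_union :: "('v, 'd) dgraph \<Rightarrow> ('w, 'd) dgraph \<Rightarrow> ('v + 'w, 'd) dgraph" where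
  "disjoint_union G H =
     \<lparr>verts = Inl ` verts G \<union> Inr ` verts H,
      edges = (image Inl) ` edges G \<union> (image Inr) ` edges H,
      dec = case_sum (dec G) (dec H)\<rparr>"

definition induced :: "('v, 'd) dgraph \<Rightarrow> 'v set \<Rightarrow> ('v, 'd) dgraph" where
  "induced G I = \<lparr>verts = I, edges = {e \<in> edges G. e \<subseteq> I}, dec = dec G\<rparr>"

text \<open>The empty graph does not count as connected.\<close>

definition connected_graph :: "('v, 'd) dgraph \<Rightarrow> bool" where
  "connected_graph G \<longleftrightarrow> verts G \<noteq> {} \<and>
     (\<forall>x\<in>verts G. \<forall>y\<in>verts G. (x, y) \<in> {(u, v). {u, v} \<in> edges G}\<^sup>*)"

text \<open>
  The decorations live in a semigroup, so the library's \<^const>\<open>sum\<close> does not apply; we adjoin a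
  unit \<^const>\<open>None\<close>. The value is meaningful for finite nonempty sets only.
\<close>

definition semigroup_sum :: "('a \<Rightarrow> 'd::ab_semigroup_add) \<Rightarrow> 'a set \<Rightarrow> 'd" where
  "semigroup_sum f A = the (Finite_Set.fold
     (\<lambda>x acc. Some (case acc of None \<Rightarrow> f x | Some s \<Rightarrow> f x + s)) None A)"

definition contract :: "('v, 'd::ab_semigroup_add) dgraph \<Rightarrow> ('v \<times> 'v) set \<Rightarrow> ('v set, 'd) dgraph" where
  "contract G r =
     \<lparr>verts = verts G // r,
      edges = {{c, c'} | c c'. c \<in> verts G // r \<and> c' \<in> verts G // r \<and> c \<noteq> c' \<and>
                               (\<exists>x\<in>c. \<exists>y\<in>c'. {x, y} \<in> edges G)},
      dec = semigroup_sum (dec G)\<rparr>"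

definition restrict_edges :: "('v, 'd) dgraph \<Rightarrow> ('v \<times> 'v) set \<Rightarrow> ('v, 'd) dgraph" where
  "restrict_edges G r =
     \<lparr>verts = verts G,
      edges = {{x, y} | x y. {x, y} \<in> edges G \<and> (x, y) \<in> r},
      dec = dec G\<rparr>"

definition connected_equivs :: "('v, 'd) dgraph \<Rightarrow> ('v \<times> 'v) set set" where
  "connected_equivs G =
     {r. equiv (verts G) r \<and> (\<forall>c \<in> verts G // r. connected_graph (induced G c))}"

definition cl :: "('v, 'd) dgraph \<Rightarrow> ('v \<times> 'v) set \<Rightarrow> nat" where
  "cl G r = card (verts G // r)"

text \<open>An orientation is the set of its arcs: exactly one of the two arcs for each edge.\<close>

definition orientations :: "('v, 'd) dgraph \<Rightarrow> ('v \<times> 'v) set set" where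
  "orientations G =
     {R. (\<forall>x y. (x, y) \<in> R \<longrightarrow> {x, y} \<in> edges G) \<and>
         (\<forall>x y. {x, y} \<in> edges G \<longrightarrow> ((x, y) \<in> R) \<noteq> ((y, x) \<in> R))}"

definition acyclic_orientations :: "('v, 'd) dgraph \<Rightarrow> ('v \<times> 'v) set set" where
  "acyclic_orientations G = {R \<in> orientations G. acyclic R}"


section \<open>Isomorphism classes\<close>

text \<open>
  Every finite graph is isomorphic to one with vertices in \<^typ>\<open>nat\<close>. So the isoclass of a graph
  over an arbitrary vertex type can be represented by the set of its isomorphic copies over
  \<^typ>\<open>nat\<close>.
\<close>

definition nat_copies :: "('v, 'd) dgraph \<Rightarrow> (nat, 'd) dgraph set" where
  "nat_copies G = {H. is_graph H \<and> isomorphic G H}"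

typedef 'd isoclass = "{nat_copies G | G :: (nat, 'd) dgraph. is_graph G}"
  morphisms members Abs_isoclass
proof -
  have "is_graph (empty_graph :: (nat, 'd) dgraph)"
    by (simp add: is_graph_def empty_graph_def)
  then show ?thesis by blast
qed

definition isoclass_of :: "('v, 'd) dgraph \<Rightarrow> 'd isoclass" where
  "isoclass_of G = Abs_isoclass (nat_copies G)"

definition representative :: "'d isoclass \<Rightarrow> (nat, 'd) dgraph" where
  "representative c = (SOME G. G \<in> members c)"


section \<open>Free vector spaces over the rationals\<close>

text \<open>
  The vector space with basis \<open>'b\<close> is \<^typ>\<open>'b \<Rightarrow>\<^sub>0 rat\<close>; the tensor product of the spaces with
  bases \<open>'b\<close> and \<open>'c\<close> is the space with basis \<^typ>\<open>'b \<times> 'c\<close>.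
\<close>

definition scale :: "rat \<Rightarrow> ('b \<Rightarrow>\<^sub>0 rat) \<Rightarrow> ('b \<Rightarrow>\<^sub>0 rat)" where
  "scale a x = Poly_Mapping.map ((*) a) x"

abbreviation basis :: "'b \<Rightarrow> ('b \<Rightarrow>\<^sub>0 rat)" where
  "basis b \<equiv> Poly_Mapping.single b 1"

definition lin_ext :: "('b \<Rightarrow> ('c \<Rightarrow>\<^sub>0 rat)) \<Rightarrow> ('b \<Rightarrow>\<^sub>0 rat) \<Rightarrow> ('c \<Rightarrow>\<^sub>0 rat)" where
  "lin_ext f x = (\<Sum>b\<in>Poly_Mapping.keys x. scale (Poly_Mapping.lookup x b) (f b))"

abbreviation linear_map :: "(('b \<Rightarrow>\<^sub>0 rat) \<Rightarrow> ('c \<Rightarrow>\<^sub>0 rat)) \<Rightarrow> bool" where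
  "linear_map \<equiv> Vector_Spaces.linear scale scale"

definition tensor :: "('b \<Rightarrow>\<^sub>0 rat) \<Rightarrow> ('c \<Rightarrow>\<^sub>0 rat) \<Rightarrow> ('b \<times> 'c \<Rightarrow>\<^sub>0 rat)" where
  "tensor x y = lin_ext (\<lambda>b. lin_ext (\<lambda>c. basis (b, c)) y) x"

text \<open>The tensor product of two maps, which are meant to be linear.\<close>

definition tensor_map ::
  "(('b \<Rightarrow>\<^sub>0 rat) \<Rightarrow> ('b' \<Rightarrow>\<^sub>0 rat)) \<Rightarrow> (('c \<Rightarrow>\<^sub>0 rat) \<Rightarrow> ('c' \<Rightarrow>\<^sub>0 rat)) \<Rightarrow>
   ('b \<times> 'c \<Rightarrow>\<^sub>0 rat) \<Rightarrow> ('b' \<times> 'c' \<Rightarrow>\<^sub>0 rat)" where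
  "tensor_map S T = lin_ext (\<lambda>(b, c). tensor (S (basis b)) (T (basis c)))"


section \<open>The Hopf algebra of decorated graphs and its antipode\<close>

type_synonym 'd graph_alg = "'d isoclass \<Rightarrow>\<^sub>0 rat"
type_synonym 'd graph_alg2 = "'d isoclass \<times> 'd isoclass \<Rightarrow>\<^sub>0 rat"

definition graph_vec :: "('v, 'd) dgraph \<Rightarrow> 'd graph_alg" where
  "graph_vec G = basis (isoclass_of G)"

definition mult :: "'d graph_alg2 \<Rightarrow> 'd graph_alg" where
  "mult = lin_ext (\<lambda>(c, c'). graph_vec (disjoint_union (representative c) (representative c')))"

definition graph_coproduct :: "('v, 'd) dgraph \<Rightarrow> 'd graph_alg2" where
  "graph_coproduct G =
     (\<Sum>(I, J) \<in> {(I, J). I \<union> J = verts G \<and> I \<inter> J = {}}.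
        tensor (graph_vec (induced G I)) (graph_vec (induced G J)))"

definition coproduct :: "'d graph_alg \<Rightarrow> 'd graph_alg2" where
  "coproduct = lin_ext (\<lambda>c. graph_coproduct (representative c))"

definition unit_elem :: "'d graph_alg" where
  "unit_elem = graph_vec (empty_graph :: (nat, 'd) dgraph)"

text \<open>The counit of \<^const>\<open>coproduct\<close>: it is 1 on the empty graph and 0 on all other graphs.\<close>

definition counit :: "'d graph_alg \<Rightarrow> rat" where
  "counit x = Poly_Mapping.lookup x (isoclass_of (empty_graph :: (nat, 'd) dgraph))"

definition is_antipode :: "('d graph_alg \<Rightarrow> 'd graph_alg) \<Rightarrow> bool" where
  "is_antipode S \<longleftrightarrow> linear_map S \<and>
     (\<forall>x. mult (tensor_map S id (coproduct x)) = scale (counit x) unit_elem) \<and>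
     (\<forall>x. mult (tensor_map id S (coproduct x)) = scale (counit x) unit_elem)"

definition antipode :: "'d graph_alg \<Rightarrow> 'd graph_alg" where
  "antipode = (THE S. is_antipode S)"


section \<open>Consistency of the definitions\<close>

text \<open>
  In particular, \<^const>\<open>mult\<close> and \<^const>\<open>coproduct\<close> do not depend on the chosen
  representatives: see \<open>mult_graph_vec\<close> and \<open>coproduct_graph_vec\<close>.
\<close>

lemma semigroup_sum_singleton: "semigroup_sum f {x} = f x"
proof -
  let ?g = "\<lambda>x acc. Some (case acc of None \<Rightarrow> f x | Some s \<Rightarrow> f x + s)"
  interpret comp_fun_commute ?g
    by standard (auto simp: fun_eq_iff ac_simps split: option.splits)
  show ?thesis by (simp add: semigroup_sum_def)
qed

lemma semigroup_sum_insert: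
  assumes "finite A" "A \<noteq> {}" "x \<notin> A"
  shows "semigroup_sum f (insert x A) = f x + semigroup_sum f A"
proof -
  let ?g = "\<lambda>x acc. Some (case acc of None \<Rightarrow> f x | Some s \<Rightarrow> f x + s)"
  interpret comp_fun_commute ?g
    by standard (auto simp: fun_eq_iff ac_simps split: option.splits)
  obtain y B where "A = insert y B" "y \<notin> B" "finite B"
    using assms by (metis ex_in_conv finite_insert mk_disjoint_insert)
  then show ?thesis using assms
    by (auto simp: semigroup_sum_def split: option.splits)
qed

lemma is_graph_induced: "is_graph G \<Longrightarrow> I \<subseteq> verts G \<Longrightarrow> is_graph (induced G I)"
  by (auto simp: is_graph_def induced_def intro: finite_subset)

lemma is_graph_restrict_edges: "is_graph G \<Longrightarrow> is_graph (restrict_edges G r)"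
  by (auto simp: is_graph_def restrict_edges_def)

lemma is_graph_contract: "is_graph G \<Longrightarrow> equiv (verts G) r \<Longrightarrow> is_graph (contract G r)"
  by (auto simp: is_graph_def contract_def equiv_def intro: finite_quotient) (metis card_2_iff)+

lemma is_graph_empty: "is_graph empty_graph"
  by (simp add: is_graph_def empty_graph_def)

lemma is_graph_disjoint_union:
  assumes "is_graph G" "is_graph H"
  shows "is_graph (disjoint_union G H)"
  using assms unfolding is_graph_def disjoint_union_def
  by (simp add: ball_Un card_image) blast

lemma graph_iso_inv:
  assumes "graph_iso f G H" shows "graph_iso (inv_into (verts G) f) H G"
proof -
  have b: "bij_betw f (verts G) (verts H)" using assms by (simp add: graph_iso_def)
  let ?g = "inv_into (verts G) f"
  have g: "?g y \<in> verts G" "f (?g y) = y" if "y \<in> verts H" for y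
    using b that by (auto simp: bij_betw_def inv_into_into f_inv_into_f)
  show ?thesis unfolding graph_iso_def
    using assms g bij_betw_inv_into[OF b] by (auto simp: graph_iso_def) (metis g)+
qed

lemma graph_iso_comp:
  assumes "graph_iso f G H" "graph_iso g H K" shows "graph_iso (g \<circ> f) G K"
proof -
  have "\<forall>x\<in>verts G. f x \<in> verts H"
    using assms by (auto simp: graph_iso_def bij_betw_def)
  then show ?thesis using assms by (auto simp: graph_iso_def intro: bij_betw_trans)
qed

lemma isomorphic_refl: "isomorphic G G"
  unfolding isomorphic_def graph_iso_def by (rule exI[of _ id]) auto

lemma isomorphic_sym: "isomorphic G H \<Longrightarrow> isomorphic H G"
  unfolding isomorphic_def using graph_iso_inv by blast

lemma isomorphic_trans: "isomorphic G H \<Longrightarrow> isomorphic H K \<Longrightarrow> isomorphic G K"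
  unfolding isomorphic_def using graph_iso_comp by blast

lemma ex_nat_copy:
  assumes "is_graph G"
  obtains H :: "(nat, 'd) dgraph" where "is_graph H" "isomorphic (G :: ('v, 'd) dgraph) H"
proof -
  obtain f :: "'v \<Rightarrow> nat" where f: "inj_on f (verts G)"
    using assms finite_imp_inj_to_nat_seg unfolding is_graph_def by metis
  define H where "H = \<lparr>verts = f ` verts G, edges = image f ` edges G,
    dec = dec G \<circ> inv_into (verts G) f\<rparr>"
  have sub: "e \<subseteq> verts G" "card e = 2" if "e \<in> edges G" for e
    using assms that by (auto simp: is_graph_def)
  have "is_graph H"
    using assms sub f unfolding is_graph_def H_def
    by (auto simp: card_image inj_on_subset)
  moreover have "{x, y} \<in> edges G \<longleftrightarrow> {f x, f y} \<in> edges H" if "x \<in> verts G" "y \<in> verts G" for x y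
  proof
    assume "{f x, f y} \<in> edges H"
    then obtain e where e: "e \<in> edges G" "f ` e = f ` {x, y}" by (auto simp: H_def)
    then have "e = {x, y}" using inj_on_image_eq_iff[OF f, of e "{x, y}"] sub that by auto
    then show "{x, y} \<in> edges G" using e by simp
  next
    assume "{x, y} \<in> edges G"
    then have "f ` {x, y} \<in> edges H" unfolding H_def dgraph.select_convs by (rule imageI)
    then show "{f x, f y} \<in> edges H" by simp
  qed
  then have "graph_iso f G H"
    using f unfolding graph_iso_def by (auto simp: bij_betw_def H_def)
  ultimately show ?thesis using that isomorphic_def by blast
qed

lemma nat_copies_cong:
  assumes "isomorphic G H"
  shows "nat_copies G = nat_copies H"
  unfolding nat_copies_def
  using isomorphic_trans[OF assms] isomorphic_trans[OF isomorphic_sym[OF assms]] by blast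

lemma members_isoclass_of:
  fixes G :: "('v, 'd) dgraph"
  assumes "is_graph G"
  shows "members (isoclass_of G) = nat_copies G"
proof -
  obtain H :: "(nat, 'd) dgraph" where H: "is_graph H" "isomorphic G H"
    using ex_nat_copy[OF assms] .
  then show ?thesis
    unfolding isoclass_of_def nat_copies_cong[OF H(2)] by (intro Abs_isoclass_inverse) blast
qed

lemma isoclass_of_eq_iff:
  fixes G :: "('v, 'd) dgraph" and H :: "('w, 'd) dgraph"
  assumes "is_graph G" "is_graph H"
  shows "isoclass_of G = isoclass_of H \<longleftrightarrow> isomorphic G H"
proof
  assume "isoclass_of G = isoclass_of H"
  then have eq: "nat_copies G = nat_copies H"
    using members_isoclass_of assms by metis
  obtain K :: "(nat, 'd) dgraph" where K: "is_graph K" "isomorphic G K"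
    using ex_nat_copy[OF assms(1)] .
  then have "K \<in> nat_copies H" unfolding eq[symmetric] by (simp add: nat_copies_def)
  then have "isomorphic H K" by (simp add: nat_copies_def)
  then show "isomorphic G H" by (rule isomorphic_trans[OF K(2) isomorphic_sym])
next
  assume "isomorphic G H"
  then show "isoclass_of G = isoclass_of H" by (simp add: isoclass_of_def nat_copies_cong)
qed

lemma representative_isoclass_of:
  fixes G :: "('v, 'd) dgraph"
  assumes "is_graph G"
  shows "is_graph (representative (isoclass_of G))"
    and "isomorphic G (representative (isoclass_of G))"
proof -
  obtain H :: "(nat, 'd) dgraph" where "is_graph H" "isomorphic G H"
    using ex_nat_copy[OF assms] .
  then have "\<exists>H. H \<in> nat_copies G" by (auto simp: nat_copies_def)
  then have "representative (isoclass_of G) \<in> nat_copies G"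
    unfolding representative_def members_isoclass_of[OF assms] by (rule someI_ex)
  then show "is_graph (representative (isoclass_of G))"
    "isomorphic G (representative (isoclass_of G))" by (auto simp: nat_copies_def)
qed

lemma lookup_scale: "Poly_Mapping.lookup (scale a x) k = a * Poly_Mapping.lookup x k"
  by (simp add: scale_def map.rep_eq when_def)

lemma vector_space_scale: "vector_space scale"
  by standard (auto intro!: poly_mapping_eqI simp: lookup_scale lookup_add algebra_simps)

lemma lin_ext_superset:
  assumes "finite A" "Poly_Mapping.keys x \<subseteq> A"
  shows "lin_ext f x = (\<Sum>b\<in>A. scale (Poly_Mapping.lookup x b) (f b))"
  unfolding lin_ext_def
  by (rule sum.mono_neutral_left)
     (use assms in \<open>auto intro!: poly_mapping_eqI simp: lookup_scale in_keys_iff\<close>)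

lemma lin_ext_basis [simp]: "lin_ext f (basis b) = f b"
  by (auto simp: lin_ext_def intro!: poly_mapping_eqI simp: lookup_scale)

lemma linear_lin_ext: "linear_map (lin_ext f)"
proof -
  interpret vs2: vector_space "scale :: rat \<Rightarrow> ('b \<Rightarrow>\<^sub>0 rat) \<Rightarrow> _"
    by (rule vector_space_scale)
  show ?thesis unfolding Vector_Spaces.linear_iff
  proof (intro conjI vector_space_scale allI)
    fix x y :: "'a \<Rightarrow>\<^sub>0 rat"
    let ?A = "Poly_Mapping.keys x \<union> Poly_Mapping.keys y"
    have "Poly_Mapping.keys (x + y) \<subseteq> ?A" by (rule keys_add)
    then show "lin_ext f (x + y) = lin_ext f x + lin_ext f y"
      by (simp add: lin_ext_superset[of ?A] lookup_add vs2.scale_left_distrib sum.distrib)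
  next
    fix r and x :: "'a \<Rightarrow>\<^sub>0 rat"
    have "Poly_Mapping.keys (scale r x) \<subseteq> Poly_Mapping.keys x"
      by (auto simp: in_keys_iff lookup_scale)
    then show "lin_ext f (scale r x) = scale r (lin_ext f x)"
      by (simp add: lin_ext_superset[of "Poly_Mapping.keys x"] lookup_scale vs2.scale_sum_right)
  qed
qed

lemma lookup_tensor:
  "Poly_Mapping.lookup (tensor x y) (b, c) = Poly_Mapping.lookup x b * Poly_Mapping.lookup y c"
proof -
  have s: "Poly_Mapping.lookup (sum g A) k = (\<Sum>a\<in>A. Poly_Mapping.lookup (g a) k)"
    for g :: "'x \<Rightarrow> ('y \<Rightarrow>\<^sub>0 rat)" and A k
    by (induction A rule: infinite_finite_induct) (auto simp: lookup_add)
  have "Poly_Mapping.lookup (tensor x y) (b, c) =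
     (\<Sum>b'\<in>Poly_Mapping.keys x. \<Sum>c'\<in>Poly_Mapping.keys y.
        if c' = c then (if b' = b then Poly_Mapping.lookup x b' * Poly_Mapping.lookup y c' else 0) else 0)"
    by (auto simp: tensor_def lin_ext_def s lookup_scale lookup_single when_def sum_distrib_left
        simp del: sum.delta sum.delta' intro!: sum.cong)
  also have "\<dots> = (\<Sum>b'\<in>Poly_Mapping.keys x. if b' = b then Poly_Mapping.lookup x b' * Poly_Mapping.lookup y c else 0)"
    by (intro sum.cong refl) (auto simp: sum.delta in_keys_iff)
  also have "\<dots> = Poly_Mapping.lookup x b * Poly_Mapping.lookup y c"
    by (simp add: sum.delta in_keys_iff)
  finally show ?thesis .
qed

lemma tensor_basis [simp]: "tensor (basis b) (basis c) = basis (b, c)"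
  by (simp add: tensor_def)

lemma edges_disjoint_union:
  "{Inl x, Inl y} \<in> edges (disjoint_union A B) \<longleftrightarrow> {x, y} \<in> edges A"
  "{Inr u, Inr v} \<in> edges (disjoint_union A B) \<longleftrightarrow> {u, v} \<in> edges B"
  "{Inl x, Inr v} \<notin> edges (disjoint_union A B)" "{Inr v, Inl x} \<notin> edges (disjoint_union A B)"
proof -
  have l: "{Inl x, Inl y} = Inl ` e \<longleftrightarrow> {x, y} = e" for e
    using inj_image_eq_iff[OF inj_Inl, of "{x, y}" e] by simp
  have r: "{Inr u, Inr v} = Inr ` e \<longleftrightarrow> {u, v} = e" for e
    using inj_image_eq_iff[OF inj_Inr, of "{u, v}" e] by simp
  have lr: "{Inl x, Inl y} \<noteq> Inr ` e" "{Inr u, Inr v} \<noteq> Inl ` e'"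
    "{Inl x, Inr v} \<noteq> Inl ` e'" "{Inl x, Inr v} \<noteq> Inr ` e"
    "{Inr v, Inl x} \<noteq> Inl ` e'" "{Inr v, Inl x} \<noteq> Inr ` e" for e e'
    by (metis imageE insertI1 insertI2 Inl_Inr_False Inr_Inl_False)+
  show "{Inl x, Inl y} \<in> edges (disjoint_union A B) \<longleftrightarrow> {x, y} \<in> edges A"
    "{Inr u, Inr v} \<in> edges (disjoint_union A B) \<longleftrightarrow> {u, v} \<in> edges B"
    "{Inl x, Inr v} \<notin> edges (disjoint_union A B)" "{Inr v, Inl x} \<notin> edges (disjoint_union A B)"
    by (simp_all add: disjoint_union_def image_iff l r lr)
qed

lemma isomorphic_disjoint_union:
  assumes "isomorphic G G'" "isomorphic H H'"
  shows "isomorphic (disjoint_union G H) (disjoint_union G' H')"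
proof -
  obtain f g where f: "graph_iso f G G'" and g: "graph_iso g H H'"
    using assms by (auto simp: isomorphic_def)
  have "graph_iso (map_sum f g) (disjoint_union G H) (disjoint_union G' H')"
    unfolding graph_iso_def
  proof (intro conjI ballI)
    have f': "inj_on f (verts G)" "f ` verts G = verts G'" using f by (auto simp: graph_iso_def bij_betw_def)
    have g': "inj_on g (verts H)" "g ` verts H = verts H'" using g by (auto simp: graph_iso_def bij_betw_def)
    have "inj_on (map_sum f g) (Inl ` verts G \<union> Inr ` verts H)"
      by (intro inj_onI) (use f'(1) g'(1) in \<open>auto dest: inj_onD\<close>)
    moreover have "map_sum f g ` (Inl ` verts G \<union> Inr ` verts H) = Inl ` verts G' \<union> Inr ` verts H'"
      unfolding f'(2)[symmetric] g'(2)[symmetric] by (simp add: image_Un image_image)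
    ultimately show "bij_betw (map_sum f g) (verts (disjoint_union G H)) (verts (disjoint_union G' H'))"
      by (simp add: bij_betw_def disjoint_union_def)
  next
    fix x y assume "x \<in> verts (disjoint_union G H)" "y \<in> verts (disjoint_union G H)"
    then have "(\<exists>a\<in>verts G. x = Inl a) \<or> (\<exists>a\<in>verts H. x = Inr a)"
         "(\<exists>a\<in>verts G. y = Inl a) \<or> (\<exists>a\<in>verts H. y = Inr a)"
      by (auto simp: disjoint_union_def)
    then show "{x, y} \<in> edges (disjoint_union G H) \<longleftrightarrow>
      {map_sum f g x, map_sum f g y} \<in> edges (disjoint_union G' H')"
      using f g by (elim disjE bexE) (simp_all add: edges_disjoint_union graph_iso_def)
  next
    fix x assume "x \<in> verts (disjoint_union G H)"
    then show "dec (disjoint_union G' H') (map_sum f g x) = dec (disjoint_union G H) x"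
      using f g by (auto simp: disjoint_union_def graph_iso_def)
  qed
  then show ?thesis unfolding isomorphic_def by blast
qed

lemma mult_graph_vec:
  assumes "is_graph G" "is_graph H"
  shows "mult (tensor (graph_vec G) (graph_vec H)) = graph_vec (disjoint_union G H)"
proof -
  let ?r = "\<lambda>G. representative (isoclass_of G)"
  have "isoclass_of (disjoint_union (?r G) (?r H)) = isoclass_of (disjoint_union G H)"
    by (subst isoclass_of_eq_iff) (intro is_graph_disjoint_union isomorphic_disjoint_union 
        representative_isoclass_of assms isomorphic_sym[OF representative_isoclass_of(2)])+
  then show ?thesis by (simp add: mult_def graph_vec_def)
qed

lemma graph_iso_induced:
  assumes "graph_iso f G H" "I \<subseteq> verts G"
  shows "graph_iso f (induced G I) (induced H (f ` I))"
proof -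
  have "x \<in> verts G" if "x \<in> I" for x using assms(2) that by blast
  then show ?thesis using assms unfolding graph_iso_def induced_def
    by (simp add: bij_betw_def) (meson inj_on_subset)
qed

lemma graph_coproduct_cong:
  assumes G: "is_graph G" and H: "is_graph H" and iso: "isomorphic G H"
  shows "graph_coproduct G = graph_coproduct H"
proof -
  obtain f where f: "graph_iso f G H" using iso by (auto simp: isomorphic_def)
  have b: "inj_on f (verts G)" "f ` verts G = verts H" using f by (auto simp: graph_iso_def bij_betw_def)
  let ?g = "inv_into (verts G) f"
  let ?P = "\<lambda>A. {(I, J). I \<union> J = A \<and> I \<inter> J = {}}"
  have eq: "graph_vec (induced H (f ` I)) = graph_vec (induced G I)" if "I \<subseteq> verts G" for I
  proof -
    have "is_graph (induced G I)" "is_graph (induced H (f ` I))"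
      using that b G H by (auto intro!: is_graph_induced)
    moreover have "isomorphic (induced G I) (induced H (f ` I))"
      using graph_iso_induced[OF f that] isomorphic_def by blast
    ultimately show ?thesis using isoclass_of_eq_iff by (metis graph_vec_def)
  qed
  show ?thesis unfolding graph_coproduct_def
  proof (rule sum.reindex_bij_witness[where j = "\<lambda>(I, J). (f ` I, f ` J)"
        and i = "\<lambda>(I, J). (?g ` I, ?g ` J)"], goal_cases)
    case (1 a)
    then obtain I J where IJ: "a = (I, J)" "I \<subseteq> verts G" "J \<subseteq> verts G" by auto
    then show ?case using inv_into_image_cancel[OF b(1)] by simp
  next
    case (2 a)
    then obtain I J where IJ: "a = (I, J)" "I \<union> J = verts G" "I \<inter> J = {}" by auto
    then have "f ` I \<inter> f ` J = {}" using inj_on_image_Int[OF b(1), of I J] by auto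
    then show ?case using IJ b by (auto simp: image_Un[symmetric])
  next
    case (3 c)
    then obtain I J where IJ: "c = (I, J)" "I \<subseteq> verts H" "J \<subseteq> verts H" by auto
    then show ?case using image_inv_into_cancel[OF b(2)] by simp
  next
    case (4 c)
    then obtain I J where IJ: "c = (I, J)" "I \<union> J = verts H" "I \<inter> J = {}" by auto
    have "inj_on ?g (verts H)" using b by (metis inj_on_inv_into order_refl)
    then have "?g ` I \<inter> ?g ` J = {}" using inj_on_image_Int[of ?g "verts H" I J] IJ by auto
    moreover have "?g ` verts H = verts G" using inv_into_image_cancel[OF b(1) order_refl] b(2) by simp
    ultimately show ?case using IJ by (auto simp: image_Un[symmetric])
  next
    case (5 a)
    then obtain I J where "a = (I, J)" "I \<subseteq> verts G" "J \<subseteq> verts G" by auto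
    then show ?case by (simp add: eq)
  qed
qed

lemma coproduct_graph_vec:
  assumes "is_graph G"
  shows "coproduct (graph_vec G) = graph_coproduct G"
  using graph_coproduct_cong[OF assms representative_isoclass_of[OF assms]]
  by (simp add: coproduct_def graph_vec_def)

end

theory Submission
  imports Defs
begin

text \<open>
  Write \<open>F(G)\<close> for the sum over \<open>\<sim> \<triangleleft> G\<close> that is claimed to be \<open>S(G)\<close>.

  The coproduct splits the vertex set into two parts. So the axiom that \<open>S\<close> is a left convolution
  inverse of the identity says that the sum of \<open>S(G|I) (G|(V - I))\<close> over all \<open>I \<subseteq> V\<close> is the unit
  when \<open>G\<close> is empty and vanishes otherwise. The term \<open>I = V\<close> is \<open>S(G)\<close> itself, hence this identity
  is a recursion on the number of vertices, with exactly one solution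
  (\<open>convolution_left_inverse_unique\<close>). Both the uniqueness of the antipode and the invariance of
  \<open>F\<close> under isomorphism are instances of that. The right antipode axiom follows from the left
  one, since the algebra is commutative and the coproduct is cocommutative. Therefore it suffices that \<open>F\<close>
  solves the recursion (\<open>antipode_eq_left_inverse\<close>).

  To prove this, expand the sum of \<open>F(G|I) (G|(V - I))\<close>. It has a term for every
  \<open>I\<close> and every \<open>\<sim> \<triangleleft> G|I\<close>. Extend \<open>\<sim>\<close> to \<open>V\<close> by the connected components of \<open>G|(V - I)\<close>. The result
  \<open>\<approx> \<triangleleft> G\<close> satisfies \<open>(G|I)|\<sim> \<cdot> G|(V - I) = G|\<approx>\<close>, and the components form a set \<open>K\<close> of vertices of
  \<open>G/\<approx>\<close> without edges between them. Conversely, \<open>\<approx>\<close> and any such independent set \<open>K\<close> determine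
  \<open>I\<close> and \<open>\<sim>\<close>. Hence the coefficient of \<open>G|\<approx>\<close> is, up to sign, the sum over the independent sets
  \<open>K\<close> of \<open>H = G/\<approx>\<close> of \<open>(-1)^|K|\<close> times the number of acyclic orientations of \<open>H - K\<close>. Orienting all
  edges at \<open>K\<close> away from \<open>K\<close> turns the latter into the acyclic orientations of \<open>H\<close> in which all
  elements of \<open>K\<close> are sources; so the sum runs over the acyclic orientations of \<open>H\<close> together with
  a set \<open>K\<close> of their sources. An acyclic orientation of a nonempty graph has a source, so the signs
  cancel (\<open>alternating_sum_acyclic_orientations\<close>).
\<close>

section \<open>Linear maps on free vector spaces\<close>

lemma linear_map_sum: "linear_map f \<Longrightarrow> f (\<Sum>i\<in>A. g i) = (\<Sum>i\<in>A. f (g i))"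
  by (simp add: Vector_Spaces.linear_iff_module_hom module_hom.sum)

lemma linear_map_scale: "linear_map f \<Longrightarrow> f (scale a x) = scale a (f x)"
  by (simp add: Vector_Spaces.linear_iff)

lemma linear_map_comp: "linear_map f \<Longrightarrow> linear_map g \<Longrightarrow> linear_map (\<lambda>x. f (g x))"
  by (simp add: Vector_Spaces.linear_iff)

lemma linear_map_eqI:
  fixes f g :: "('b \<Rightarrow>\<^sub>0 rat) \<Rightarrow> ('c \<Rightarrow>\<^sub>0 rat)"
  assumes "linear_map f" "linear_map g" "\<And>b. f (basis b) = g (basis b)"
  shows "f x = g x"
proof -
  have x: "x = lin_ext basis x"
    unfolding lin_ext_def
    by (rule poly_mapping_eqI)
       (simp add: lookup_sum lookup_scale lookup_single when_def in_keys_iff if_distrib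
          cong: if_cong)
  have "h x = (\<Sum>b\<in>Poly_Mapping.keys x. scale (Poly_Mapping.lookup x b) (h (basis b)))"
    if "linear_map h" for h :: "_ \<Rightarrow> ('c \<Rightarrow>\<^sub>0 rat)"
    by (subst x) (simp add: lin_ext_def linear_map_sum[OF that] linear_map_scale[OF that])
  from this[OF assms(1)] this[OF assms(2)] show ?thesis using assms(3) by simp
qed

section \<open>Products of graphs\<close>

lemma linear_map_mult: "linear_map mult"
  unfolding mult_def by (rule linear_lin_ext)

lemma linear_map_tensor_left: "linear_map (\<lambda>x. tensor x y)"
  unfolding tensor_def by (rule linear_lin_ext)

lemma linear_map_tensor_right: "linear_map (tensor x)"
  by (simp add: Vector_Spaces.linear_iff vector_space_scale)
     (auto intro!: poly_mapping_eqI simp: lookup_tensor lookup_add lookup_scale algebra_simps)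

abbreviation times_alg :: "'d graph_alg \<Rightarrow> 'd graph_alg \<Rightarrow> 'd graph_alg"  (infixl "\<star>" 70) where
  "x \<star> y \<equiv> mult (tensor x y)"

lemma linear_map_times_left: "linear_map (\<lambda>x. x \<star> y)"
  by (rule linear_map_comp[OF linear_map_mult linear_map_tensor_left])

lemma linear_map_times_right: "linear_map (\<lambda>y. x \<star> y)"
  by (rule linear_map_comp[OF linear_map_mult linear_map_tensor_right])

lemma graph_vec_eqI:
  "is_graph G \<Longrightarrow> is_graph H \<Longrightarrow> isomorphic G H \<Longrightarrow> graph_vec G = graph_vec H"
  unfolding graph_vec_def using isoclass_of_eq_iff by metis

lemma representative_props:
  shows "is_graph (representative c)" and "isoclass_of (representative c) = c"
proof -
  obtain G :: "(nat, 'a) dgraph" where G: "is_graph G" "c = isoclass_of G"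
    by (cases c) (auto simp: isoclass_of_def)
  show "is_graph (representative c)" "isoclass_of (representative c) = c"
    using representative_isoclass_of[OF G(1)] G isoclass_of_eq_iff isomorphic_sym by metis+
qed

text \<open>
  By this and \<open>linear_map_eqI\<close>, an identity between linear maps on the algebra only has to be
  checked on graphs with vertices in \<^typ>\<open>nat\<close>.
\<close>

lemma basis_eq_graph_vec: "basis c = graph_vec (representative c)"
  by (simp add: graph_vec_def representative_props)

lemma verts_disjoint_union: "verts (disjoint_union G H) = Inl ` verts G \<union> Inr ` verts H"
  by (simp add: disjoint_union_def)

lemma isomorphic_disjoint_union_commute:
  "isomorphic (disjoint_union G H) (disjoint_union H G)"
proof -
  let ?s = "case_sum Inr Inl"
  have "graph_iso ?s (disjoint_union G H) (disjoint_union H G)"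
    unfolding graph_iso_def
  proof (intro conjI ballI)
    show "bij_betw ?s (verts (disjoint_union G H)) (verts (disjoint_union H G))"
      by (rule bij_betw_byWitness[where f' = ?s]) (auto simp: disjoint_union_def)
  next
    fix x assume "x \<in> verts (disjoint_union G H)"
    then show "dec (disjoint_union H G) (?s x) = dec (disjoint_union G H) x"
      by (auto simp: disjoint_union_def)
  qed (auto simp: edges_disjoint_union split: sum.splits)
  then show ?thesis unfolding isomorphic_def by blast
qed

lemma times_commute: "x \<star> y = y \<star> x"
proof (rule linear_map_eqI[OF linear_map_times_left linear_map_times_right])
  fix b
  show "basis b \<star> y = y \<star> basis b"
  proof (rule linear_map_eqI[OF linear_map_times_right linear_map_times_left])
    fix c
    show "basis b \<star> basis c = basis c \<star> basis b"
      unfolding basis_eq_graph_vec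
      by (simp add: mult_graph_vec representative_props graph_vec_eqI is_graph_disjoint_union
          isomorphic_disjoint_union_commute)
  qed
qed

lemma isomorphic_disjoint_union_empty:
  "isomorphic (disjoint_union G (empty_graph :: ('w, 'd) dgraph)) G"
proof -
  let ?e = "empty_graph :: ('w, 'd) dgraph"
  \<comment> \<open>The right summand has no vertices; \<open>undefined\<close> only makes the map total.\<close>
  let ?s = "case_sum id undefined"
  have "graph_iso ?s (disjoint_union G ?e) G"
    unfolding graph_iso_def
  proof (intro conjI ballI)
    show "bij_betw ?s (verts (disjoint_union G ?e)) (verts G)"
      by (rule bij_betw_byWitness[where f' = Inl]) (auto simp: disjoint_union_def empty_graph_def)
  next
    fix x y assume "x \<in> verts (disjoint_union G ?e)" "y \<in> verts (disjoint_union G ?e)"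
    then show "{x, y} \<in> edges (disjoint_union G ?e) \<longleftrightarrow> {?s x, ?s y} \<in> edges G"
      by (auto simp: verts_disjoint_union edges_disjoint_union empty_graph_def)
  qed (auto simp: disjoint_union_def empty_graph_def)
  then show ?thesis unfolding isomorphic_def by blast
qed

lemma times_unit: "x \<star> unit_elem = x"
proof (rule linear_map_eqI[OF linear_map_times_left])
  show "linear_map (\<lambda>x. x)" by (simp add: Vector_Spaces.linear_iff vector_space_scale)
  fix b
  show "basis b \<star> unit_elem = basis b"
    unfolding basis_eq_graph_vec unit_elem_def
    by (simp add: mult_graph_vec representative_props is_graph_empty graph_vec_eqI
        is_graph_disjoint_union isomorphic_disjoint_union_empty)
qed

lemma graph_vec_no_verts:
  fixes G :: "('v, 'd) dgraph"
  assumes "is_graph G" "verts G = {}"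
  shows "graph_vec G = unit_elem"
  unfolding unit_elem_def
proof (rule graph_vec_eqI[OF assms(1) is_graph_empty])
  show "isomorphic G (empty_graph :: (nat, 'd) dgraph)"
    using assms by (auto simp: isomorphic_def graph_iso_def empty_graph_def bij_betw_def)
qed

lemma induced_verts: "is_graph G \<Longrightarrow> induced G (verts G) = G"
  by (cases G) (auto simp: induced_def is_graph_def)

lemma induced_induced: "J \<subseteq> I \<Longrightarrow> induced (induced G I) J = induced G J"
  by (auto simp: induced_def)

lemma verts_induced [simp]: "verts (induced G I) = I"
  by (simp add: induced_def)

section \<open>The antipode as the unique left convolution inverse of the identity\<close>

text \<open>
  The left antipode axiom evaluated on graphs. It is a property of functions on graphs, not on
  isoclasses, so that it can be verified for an explicit formula before the formula is known to be
  invariant under isomorphism.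
\<close>

definition convolution_left_inverse :: "(('v, 'd) dgraph \<Rightarrow> 'd graph_alg) \<Rightarrow> bool" where
  "convolution_left_inverse f \<longleftrightarrow> (\<forall>G. is_graph G \<longrightarrow>
     (\<Sum>I\<in>Pow (verts G). f (induced G I) \<star> graph_vec (induced G (verts G - I))) =
     (if verts G = {} then unit_elem else 0))"

text \<open>
  The summand for \<open>I = V\<close> of the defining identity is \<open>f G\<close>, because \<open>G|{}\<close> is the unit.
\<close>

lemma convolution_left_inverse_recursion:
  assumes f: "convolution_left_inverse f" and G: "is_graph G"
  shows "f G = (if verts G = {} then unit_elem else 0) -
    (\<Sum>I\<in>Pow (verts G) - {verts G}. f (induced G I) \<star> graph_vec (induced G (verts G - I)))"
proof -
  have fin: "finite (Pow (verts G))" using G by (simp add: is_graph_def)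
  have "graph_vec (induced G {}) = unit_elem"
    by (rule graph_vec_no_verts) (auto simp: is_graph_induced[OF G])
  then have "f (induced G (verts G)) \<star> graph_vec (induced G (verts G - verts G)) = f G"
    by (simp add: induced_verts[OF G] times_unit)
  moreover have "(\<Sum>I\<in>Pow (verts G). f (induced G I) \<star> graph_vec (induced G (verts G - I))) =
     (if verts G = {} then unit_elem else 0)"
    using f G by (simp add: convolution_left_inverse_def)
  moreover note sum.remove[OF fin, of "verts G"
      "\<lambda>I. f (induced G I) \<star> graph_vec (induced G (verts G - I))"]
  ultimately show ?thesis by (simp add: eq_diff_eq del: Diff_cancel)
qed

text \<open>
  By induction on the number of vertices, both sides solve the same recursion. Taking isomorphic
  graphs over two vertex types makes this at once a uniqueness statement (for \<open>G = H\<close>) and a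
  statement of invariance under isomorphism (for \<open>f\<close> and \<open>g\<close> given by one formula).
\<close>

lemma convolution_left_inverse_unique:
  fixes G :: "('v, 'd) dgraph" and H :: "('w, 'd) dgraph"
  assumes f: "convolution_left_inverse f" and g: "convolution_left_inverse g"
    and "is_graph G" "is_graph H" "isomorphic G H"
  shows "f G = g H"
  using assms(3-)
proof (induction "card (verts G)" arbitrary: G H rule: less_induct)
  case less
  note G = less.prems(1) and H = less.prems(2)
  obtain \<phi> where \<phi>: "graph_iso \<phi> G H" using less.prems(3) by (auto simp: isomorphic_def)
  then have inj: "inj_on \<phi> (verts G)" and img: "\<phi> ` verts G = verts H"
    by (auto simp: graph_iso_def bij_betw_def)
  have iso: "isomorphic (induced G I) (induced H (\<phi> ` I))" if "I \<subseteq> verts G" for I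
    using graph_iso_induced[OF \<phi> that] isomorphic_def by blast
  have ind: "is_graph (induced G I)" "is_graph (induced H (\<phi> ` I))" if "I \<subseteq> verts G" for I
    using that img by (auto intro!: is_graph_induced G H)
  have "(\<Sum>K\<in>Pow (verts H) - {verts H}. g (induced H K) \<star> graph_vec (induced H (verts H - K))) =
        (\<Sum>I\<in>Pow (verts G) - {verts G}. f (induced G I) \<star> graph_vec (induced G (verts G - I)))"
  proof (rule sum.reindex_cong[where l = "(`) \<phi>"])
    show "inj_on ((`) \<phi>) (Pow (verts G) - {verts G})"
      using inj_on_image_Pow[OF inj] by (rule inj_on_subset) blast
    show "Pow (verts H) - {verts H} = (`) \<phi> ` (Pow (verts G) - {verts G})"
      using inj_on_image_set_diff[OF inj_on_image_Pow[OF inj], of "Pow (verts G)" "{verts G}"]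
        image_Pow_surj[OF img] img by simp
  next
    fix I assume I: "I \<in> Pow (verts G) - {verts G}"
    then have sub: "I \<subseteq> verts G" and "card I < card (verts G)"
      using G by (auto simp: is_graph_def intro!: psubset_card_mono)
    then have "f (induced G I) = g (induced H (\<phi> ` I))"
      by (intro less.hyps) (auto simp: ind iso)
    moreover have "verts H - \<phi> ` I = \<phi> ` (verts G - I)"
      using inj_on_image_set_diff[OF inj _ sub, of "verts G"] img by simp
    ultimately show "g (induced H (\<phi> ` I)) \<star> graph_vec (induced H (verts H - \<phi> ` I)) =
        f (induced G I) \<star> graph_vec (induced G (verts G - I))"
      by (simp add: graph_vec_eqI[OF ind iso])
  qed
  moreover have "verts G = {} \<longleftrightarrow> verts H = {}" using img by auto
  ultimately show ?case
    by (subst convolution_left_inverse_recursion[OF f G],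
        subst convolution_left_inverse_recursion[OF g H]) simp
qed

lemma graph_coproduct_Pow:
  "graph_coproduct G = (\<Sum>I\<in>Pow (verts G).
     tensor (graph_vec (induced G I)) (graph_vec (induced G (verts G - I))))"
  unfolding graph_coproduct_def
proof (rule sum.reindex_bij_witness[where i = "\<lambda>I. (I, verts G - I)" and j = fst])
  fix a assume "a \<in> {(I, J). I \<union> J = verts G \<and> I \<inter> J = {}}"
  then obtain I where "a = (I, verts G - I)" "I \<subseteq> verts G" by auto
  then show "(fst a, verts G - fst a) = a" "fst a \<in> Pow (verts G)"
    "tensor (graph_vec (induced G (fst a))) (graph_vec (induced G (verts G - fst a))) =
      (case a of (I, J) \<Rightarrow> tensor (graph_vec (induced G I)) (graph_vec (induced G J)))"
    by auto
qed auto

lemma convolution_graph_vec: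
  assumes "is_graph G"
  shows "mult (tensor_map S T (coproduct (graph_vec G))) =
    (\<Sum>I\<in>Pow (verts G). S (graph_vec (induced G I)) \<star> T (graph_vec (induced G (verts G - I))))"
proof -
  have *: "tensor_map S T (tensor (graph_vec A) (graph_vec B)) = tensor (S (graph_vec A)) (T (graph_vec B))"
    for A B :: "('a, 'b) dgraph"
    by (simp add: tensor_map_def graph_vec_def)
  have "linear_map (tensor_map S T)" unfolding tensor_map_def by (rule linear_lin_ext)
  then show ?thesis
    by (simp add: coproduct_graph_vec[OF assms] graph_coproduct_Pow linear_map_sum *
        linear_map_sum[OF linear_map_mult])
qed

lemma counit_graph_vec:
  fixes G :: "('v, 'd) dgraph"
  assumes "is_graph G"
  shows "scale (counit (graph_vec G)) unit_elem = (if verts G = {} then unit_elem else 0 :: 'd graph_alg)"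
proof -
  have "isomorphic G (empty_graph :: (nat, 'd) dgraph) \<longleftrightarrow> verts G = {}"
    by (auto simp: isomorphic_def graph_iso_def empty_graph_def bij_betw_def)
  then have "counit (graph_vec G) = (if verts G = {} then 1 else 0)"
    using isoclass_of_eq_iff[where H = "empty_graph :: (nat, 'd) dgraph", OF assms is_graph_empty]
    by (simp add: counit_def graph_vec_def lookup_single when_def)
  then show ?thesis by (auto intro!: poly_mapping_eqI simp: lookup_scale)
qed

lemma antipode_left_inverse:
  fixes S :: "'d graph_alg \<Rightarrow> 'd graph_alg"
  assumes "is_antipode S"
  shows "convolution_left_inverse (\<lambda>G :: ('v, 'd) dgraph. S (graph_vec G))"
  unfolding convolution_left_inverse_def
proof (intro allI impI)
  fix G :: "('v, 'd) dgraph" assume G: "is_graph G"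
  have "mult (tensor_map S id (coproduct (graph_vec G))) = scale (counit (graph_vec G)) unit_elem"
    using assms by (simp add: is_antipode_def)
  then show "(\<Sum>I\<in>Pow (verts G). S (graph_vec (induced G I)) \<star> graph_vec (induced G (verts G - I))) =
     (if verts G = {} then unit_elem else 0)"
    by (simp add: convolution_graph_vec[OF G] counit_graph_vec[OF G])
qed

text \<open>
  A left inverse \<open>h\<close> on graphs over \<^typ>\<open>nat\<close> defines a linear map through the representatives,
  and this map is the antipode: complementing the vertex sets turns the left axiom into the right
  one. The function \<open>f\<close> plays the role of \<open>h\<close> over the vertex type of the given graph.
\<close>

lemma antipode_eq_left_inverse:
  fixes f :: "('v, 'd) dgraph \<Rightarrow> 'd graph_alg" and h :: "(nat, 'd) dgraph \<Rightarrow> 'd graph_alg"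
  assumes f: "convolution_left_inverse f" and h: "convolution_left_inverse h" and G: "is_graph G"
  shows "antipode (graph_vec G) = f G"
proof -
  \<comment> \<open>The value is the same for any choice of representatives, since \<open>h\<close> is invariant.\<close>
  define S where "S = lin_ext (\<lambda>c. h (representative c))"
  have S: "S (graph_vec A) = h A" if "is_graph A" for A :: "(nat, 'd) dgraph"
  proof -
    have "S (graph_vec A) = h (representative (isoclass_of A))" by (simp add: S_def graph_vec_def)
    also have "\<dots> = h A"
      using convolution_left_inverse_unique[OF h h] representative_isoclass_of[OF that] that isomorphic_sym
      by blast
    finally show ?thesis .
  qed
  have lin: "linear_map (\<lambda>x. mult (tensor_map A B (coproduct x)))"
    for A B :: "'d graph_alg \<Rightarrow> 'd graph_alg"
    unfolding tensor_map_def coproduct_def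
    by (rule linear_map_comp[OF linear_map_mult linear_map_comp[OF linear_lin_ext linear_lin_ext]])
  have lin': "linear_map (\<lambda>x. scale (counit x) unit_elem)"
    by (simp add: Vector_Spaces.linear_iff vector_space_scale)
       (auto intro!: poly_mapping_eqI simp: lookup_scale counit_def lookup_add algebra_simps)
  have left: "(\<Sum>I\<in>Pow (verts A). S (graph_vec (induced A I)) \<star> graph_vec (induced A (verts A - I)))
     = scale (counit (graph_vec A)) unit_elem" if A: "is_graph A" for A :: "(nat, 'd) dgraph"
    using h A by (simp add: convolution_left_inverse_def counit_graph_vec S is_graph_induced)
  have right: "(\<Sum>I\<in>Pow (verts A). graph_vec (induced A I) \<star> S (graph_vec (induced A (verts A - I))))
     = scale (counit (graph_vec A)) unit_elem" if A: "is_graph A" for A :: "(nat, 'd) dgraph"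
    unfolding left[OF A, symmetric]
    by (rule sum.reindex_bij_witness[where i = "\<lambda>I. verts A - I" and j = "\<lambda>I. verts A - I"])
       (auto simp: double_diff times_commute)
  have anti: "is_antipode S"
    unfolding is_antipode_def
  proof (intro conjI allI)
    show "linear_map S" unfolding S_def by (rule linear_lin_ext)
    show "mult (tensor_map S id (coproduct x)) = scale (counit x) unit_elem" for x
      by (rule linear_map_eqI[OF lin lin'])
         (simp add: basis_eq_graph_vec convolution_graph_vec representative_props left)
    show "mult (tensor_map id S (coproduct x)) = scale (counit x) unit_elem" for x
      by (rule linear_map_eqI[OF lin lin'])
         (simp add: basis_eq_graph_vec convolution_graph_vec representative_props right)
  qed
  moreover have "T = S" if T: "is_antipode T" for T
  proof (rule ext)
    fix x
    show "T x = S x"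
    proof (rule linear_map_eqI[of T S])
      show "linear_map T" using T by (simp add: is_antipode_def)
      show "linear_map S" unfolding S_def by (rule linear_lin_ext)
      fix c
      show "T (basis c) = S (basis c)"
        unfolding basis_eq_graph_vec
        by (rule convolution_left_inverse_unique[OF antipode_left_inverse[OF T] antipode_left_inverse[OF anti]
              representative_props(1) representative_props(1) isomorphic_refl])
    qed
  qed
  ultimately have "antipode = S" unfolding antipode_def by (rule the_equality)
  moreover have "S (graph_vec G) = f G"
    by (rule convolution_left_inverse_unique[OF antipode_left_inverse[OF anti] f G G isomorphic_refl])
  ultimately show ?thesis by simp
qed

section \<open>Acyclic orientations and their sources\<close>

definition independent_set :: "('v, 'd) dgraph \<Rightarrow> 'v set \<Rightarrow> bool" where
  "independent_set G K \<longleftrightarrow> (\<forall>x\<in>K. \<forall>y\<in>K. {x, y} \<notin> edges G)"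

definition consists_of_sources :: "('v \<times> 'v) set \<Rightarrow> 'v set \<Rightarrow> bool" where
  "consists_of_sources R K \<longleftrightarrow> (\<forall>(x, y)\<in>R. y \<notin> K)"

lemma sum_alternating_Pow:
  assumes "finite A" "A \<noteq> {}"
  shows "(\<Sum>K\<in>Pow A. (-1) ^ card K) = (0 :: 'a :: comm_ring_1)"
  using prod_diff_conv_sum[OF assms(1), of "\<lambda>_. 1" "\<lambda>_. 1"] assms
  by (simp add: power_0_left)

lemma orientation_subset:
  assumes "is_graph G" "R \<in> orientations G" shows "R \<subseteq> verts G \<times> verts G"
  using assms by (force simp: orientations_def is_graph_def)

lemma finite_acyclic_orientations:
  assumes "is_graph G" shows "finite (acyclic_orientations G)"
proof (rule finite_subset)
  show "acyclic_orientations G \<subseteq> Pow (verts G \<times> verts G)"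
    using orientation_subset[OF assms] by (auto simp: acyclic_orientations_def)
qed (use assms in \<open>simp add: is_graph_def\<close>)

text \<open>
  On a finite set an acyclic relation is well-founded, and a minimal vertex is a source.
\<close>

lemma acyclic_orientation_has_source:
  assumes G: "is_graph G" and ne: "verts G \<noteq> {}" and R: "R \<in> acyclic_orientations G"
  obtains z where "z \<in> verts G" "\<And>x. (x, z) \<notin> R"
proof -
  have sub: "R \<subseteq> verts G \<times> verts G"
    using orientation_subset[OF G] R by (simp add: acyclic_orientations_def)
  then have "finite R" using G by (auto simp: is_graph_def intro: finite_subset)
  then have "wf R" using R by (simp add: finite_acyclic_wf acyclic_orientations_def)
  then obtain z where "z \<in> verts G" "\<And>y. (y, z) \<in> R \<Longrightarrow> y \<notin> verts G"
    using wfE_min[of R _ "verts G"] ne by blast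
  then show ?thesis using sub that by blast
qed

text \<open>
  No arc enters \<open>K\<close>, so a path that starts outside \<open>K\<close> never uses the arcs \<open>S\<close>, which leave \<open>K\<close>.
  In particular \<open>S\<close> adds no cycles to \<open>R\<close>.
\<close>

lemma trancl_Un_out_of:
  assumes "\<forall>(x, y)\<in>R. x \<notin> K \<and> y \<notin> K" and "\<forall>(x, y)\<in>S. x \<in> K \<and> y \<notin> K"
    and "(x, y) \<in> (R \<union> S)\<^sup>+"
  shows "y \<notin> K \<and> (x \<notin> K \<longrightarrow> (x, y) \<in> R\<^sup>+)"
  using assms(3)
proof (induction rule: trancl_induct)
  case (base y)
  then show ?case using assms(1,2) by auto
next
  case (step y z)
  then have "(y, z) \<in> R" "z \<notin> K" using assms(1,2) by auto
  with step.IH show ?case by (meson trancl_into_trancl)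
qed

text \<open>
  An orientation of \<open>G - K\<close> extends in exactly one way to an orientation of \<open>G\<close> in which
  all elements of \<open>K\<close> are sources: every edge at \<open>K\<close> has to leave \<open>K\<close>, which is consistent
  because no edge has both ends in \<open>K\<close>.
\<close>

lemma card_acyclic_orientations_sources:
  assumes G: "is_graph G" and K: "K \<subseteq> verts G" "independent_set G K"
  shows "card (acyclic_orientations (induced G (verts G - K))) =
    card {R \<in> acyclic_orientations G. consists_of_sources R K}"
proof (rule bij_betw_same_card)
  let ?I = "verts G - K"
  let ?S = "{(x, y). x \<in> K \<and> {x, y} \<in> edges G}"
  have in_verts: "x \<in> verts G" "y \<in> verts G" if "{x, y} \<in> edges G" for x y
    using G that by (auto simp: is_graph_def)
  have ind: "{x, y} \<in> edges (induced G ?I) \<longleftrightarrow> {x, y} \<in> edges G \<and> x \<notin> K \<and> y \<notin> K" for x y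
    using in_verts by (auto simp: induced_def)
  have not_both: "x \<notin> K \<or> y \<notin> K" if "{x, y} \<in> edges G" for x y
    using K that by (auto simp: independent_set_def)
  have outside: "{x, y} \<in> edges G \<and> x \<notin> K \<and> y \<notin> K"
    if "R \<in> orientations (induced G ?I)" "(x, y) \<in> R" for R x y
    using that unfolding orientations_def mem_Collect_eq ind by blast
  have S: "\<forall>(x, y)\<in>?S. x \<in> K \<and> y \<notin> K" using not_both by auto
  show "bij_betw (\<lambda>R. R \<union> ?S) (acyclic_orientations (induced G ?I))
     {R \<in> acyclic_orientations G. consists_of_sources R K}"
  proof (rule bij_betw_byWitness[where f' = "\<lambda>R. R \<inter> ?I \<times> ?I"])
    show "\<forall>R\<in>acyclic_orientations (induced G ?I). (R \<union> ?S) \<inter> ?I \<times> ?I = R"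
    proof
      fix R assume "R \<in> acyclic_orientations (induced G ?I)"
      then have "R \<subseteq> ?I \<times> ?I"
        using orientation_subset[of "induced G ?I" R] is_graph_induced[OF G, of ?I]
        by (auto simp: acyclic_orientations_def induced_def)
      then show "(R \<union> ?S) \<inter> ?I \<times> ?I = R" by auto
    qed
    show "\<forall>R\<in>{R \<in> acyclic_orientations G. consists_of_sources R K}. R \<inter> ?I \<times> ?I \<union> ?S = R"
    proof
      fix R assume "R \<in> {R \<in> acyclic_orientations G. consists_of_sources R K}"
      then have R: "R \<in> orientations G" "consists_of_sources R K" by (auto simp: acyclic_orientations_def)
      have "(x, y) \<in> R \<inter> ?I \<times> ?I \<union> ?S \<longleftrightarrow> (x, y) \<in> R" for x y
      proof -
        have "(x, y) \<in> R \<Longrightarrow> {x, y} \<in> edges G \<and> y \<notin> K"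
          using R by (auto simp: orientations_def consists_of_sources_def)
        moreover have "(x, y) \<in> R" if "x \<in> K" "{x, y} \<in> edges G"
          using R that by (auto simp: orientations_def consists_of_sources_def)
        ultimately show ?thesis using in_verts[of x y] by blast
      qed
      then show "R \<inter> ?I \<times> ?I \<union> ?S = R" by auto
    qed
    show "(\<lambda>R. R \<union> ?S) ` acyclic_orientations (induced G ?I)
        \<subseteq> {R \<in> acyclic_orientations G. consists_of_sources R K}"
    proof (rule image_subsetI)
      fix R assume "R \<in> acyclic_orientations (induced G ?I)"
      then have R: "R \<in> orientations (induced G ?I)" and ac: "acyclic R"
        by (auto simp: acyclic_orientations_def)
      note out = outside[OF R]
      have one: "((x, y) \<in> R) \<noteq> ((y, x) \<in> R)" if "{x, y} \<in> edges G" "x \<notin> K" "y \<notin> K" for x y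
        using R ind[of x y] that unfolding orientations_def by simp
      have "((x, y) \<in> R \<union> ?S) \<noteq> ((y, x) \<in> R \<union> ?S)" if e: "{x, y} \<in> edges G" for x y
        using one[OF e] out[of x y] out[of y x] not_both[OF e] e by (auto simp: insert_commute)
      moreover have "{x, y} \<in> edges G" if "(x, y) \<in> R \<union> ?S" for x y
        using that out by auto
      ultimately have "R \<union> ?S \<in> orientations G" unfolding orientations_def by blast
      moreover have "acyclic (R \<union> ?S)"
        unfolding acyclic_def
      proof (intro allI notI)
        fix x assume "(x, x) \<in> (R \<union> ?S)\<^sup>+"
        then have "(x, x) \<in> R\<^sup>+"
          using trancl_Un_out_of[of R K ?S x x] out S by blast
        then show False using ac by (simp add: acyclic_def)
      qed
      moreover have "consists_of_sources (R \<union> ?S) K"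
        using out S by (auto simp: consists_of_sources_def)
      ultimately show "R \<union> ?S \<in> {R \<in> acyclic_orientations G. consists_of_sources R K}"
        by (simp add: acyclic_orientations_def)
    qed
    show "(\<lambda>R. R \<inter> ?I \<times> ?I) ` {R \<in> acyclic_orientations G. consists_of_sources R K}
        \<subseteq> acyclic_orientations (induced G ?I)"
    proof (rule image_subsetI)
      fix R assume "R \<in> {R \<in> acyclic_orientations G. consists_of_sources R K}"
      then have R: "R \<in> orientations G" and ac: "acyclic R" by (auto simp: acyclic_orientations_def)
      have "R \<inter> ?I \<times> ?I \<in> orientations (induced G ?I)"
        using R in_verts unfolding orientations_def mem_Collect_eq ind by blast
      moreover have "acyclic (R \<inter> ?I \<times> ?I)" using ac by (rule acyclic_subset) blast
      ultimately show "R \<inter> ?I \<times> ?I \<in> acyclic_orientations (induced G ?I)"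
        by (simp add: acyclic_orientations_def)
    qed
  qed
qed

lemma sources_independent:
  assumes "R \<in> orientations G" "consists_of_sources R K"
  shows "independent_set G K"
  using assms unfolding orientations_def consists_of_sources_def independent_set_def by blast

text \<open>
  By \<open>card_acyclic_orientations_sources\<close> the left side counts, with sign \<open>(-1)^|K|\<close>, the pairs of an
  acyclic orientation of \<open>G\<close> and a set \<open>K\<close> of its sources. For a fixed orientation this is the
  alternating sum over all subsets of the set of sources, which is nonempty unless \<open>G\<close> is empty.
\<close>

lemma alternating_sum_acyclic_orientations:
  assumes G: "is_graph G"
  shows "(\<Sum>K | K \<subseteq> verts G \<and> independent_set G K. (-1) ^ card K *
      of_nat (card (acyclic_orientations (induced G (verts G - K))))) =
    (if verts G = {} then 1 else 0 :: rat)"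
proof (cases "verts G = {}")
  case True
  then have "edges G = {}" using G by (auto simp: is_graph_def)
  then have "{K. K \<subseteq> verts G \<and> independent_set G K} = {{}}"
    "acyclic_orientations (induced G {}) = {{}}"
    using True by (auto simp: independent_set_def acyclic_orientations_def orientations_def induced_def acyclic_def)
  then show ?thesis using True by simp
next
  case False
  let ?V = "verts G" and ?AO = "acyclic_orientations G"
  have fV: "finite ?V" using G by (simp add: is_graph_def)
  have fAO: "finite ?AO" by (rule finite_acyclic_orientations[OF G])
  have "(\<Sum>K | K \<subseteq> ?V \<and> independent_set G K. (-1) ^ card K *
      of_nat (card (acyclic_orientations (induced G (?V - K))))) =
    (\<Sum>K | K \<subseteq> ?V \<and> independent_set G K. \<Sum>R | R \<in> ?AO \<and> consists_of_sources R K. (-1) ^ card K :: rat)"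
    by (intro sum.cong refl) (simp add: card_acyclic_orientations_sources[OF G])
  \<comment> \<open>Other sets \<open>K\<close> contribute empty sums: two adjacent vertices are never both sources.\<close>
  also have "\<dots> = (\<Sum>K\<in>Pow ?V. \<Sum>R | R \<in> ?AO \<and> consists_of_sources R K. (-1) ^ card K)"
  proof (rule sum.mono_neutral_left)
    show "\<forall>K\<in>Pow ?V - {K. K \<subseteq> ?V \<and> independent_set G K}.
      (\<Sum>R | R \<in> ?AO \<and> consists_of_sources R K. (-1) ^ card K) = (0 :: rat)"
    proof (intro ballI sum.neutral)
      fix K R
      assume "K \<in> Pow ?V - {K. K \<subseteq> ?V \<and> independent_set G K}" "R \<in> {R \<in> ?AO. consists_of_sources R K}"
      then have False using sources_independent[of R G K] by (simp add: acyclic_orientations_def)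
      then show "(-1) ^ card K = (0 :: rat)" ..
    qed
  qed (use fV in auto)
  also have "\<dots> = (\<Sum>R\<in>?AO. \<Sum>K | K \<in> Pow ?V \<and> consists_of_sources R K. (-1) ^ card K)"
    using fV fAO by (intro sum.swap_restrict) auto
  also have "\<dots> = (\<Sum>R\<in>?AO. 0)"
  proof (intro sum.cong refl)
    fix R assume R: "R \<in> ?AO"
    let ?A = "{z \<in> ?V. \<forall>x. (x, z) \<notin> R}"
    have "{K \<in> Pow ?V. consists_of_sources R K} = Pow ?A" by (auto simp: consists_of_sources_def)
    moreover have "?A \<noteq> {}" using acyclic_orientation_has_source[OF G False R] by blast
    ultimately show "(\<Sum>K | K \<in> Pow ?V \<and> consists_of_sources R K. (-1) ^ card K) = (0 :: rat)"
      using fV by (simp add: sum_alternating_Pow)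
  qed
  finally show ?thesis using False by simp
qed

section \<open>Splitting connected partitions\<close>

lemma equiv_Un_disjoint:
  assumes "equiv A r" "equiv B s" "A \<inter> B = {}"
  shows "equiv (A \<union> B) (r \<union> s)" and "(A \<union> B) // (r \<union> s) = A // r \<union> B // s"
proof -
  have r: "r \<subseteq> A \<times> A" "s \<subseteq> B \<times> B" using assms by (auto simp: equiv_def refl_on_def)
  show "equiv (A \<union> B) (r \<union> s)"
  proof (rule equivI)
    show "r \<union> s \<subseteq> (A \<union> B) \<times> (A \<union> B)" using r by blast
    show "refl_on (A \<union> B) (r \<union> s)" "sym (r \<union> s)"
      using assms unfolding equiv_def refl_on_def sym_def by blast+
    show "trans (r \<union> s)"
    proof (rule transI)
      fix x y z assume "(x, y) \<in> r \<union> s" "(y, z) \<in> r \<union> s"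
      then show "(x, z) \<in> r \<union> s"
        using r assms(3) assms(1,2)[THEN equivE] by (metis (no_types, lifting) Un_iff disjoint_iff mem_Sigma_iff subsetD transD)
    qed
  qed
  have "(r \<union> s) `` {x} = r `` {x}" if "x \<in> A" for x using that r assms(3) by blast
  moreover have "(r \<union> s) `` {x} = s `` {x}" if "x \<in> B" for x using that r assms(3) by blast
  ultimately show "(A \<union> B) // (r \<union> s) = A // r \<union> B // s"
    unfolding quotient_def by auto
qed

text \<open>
  The classes of the restriction to a saturated set are classes of the given relation; so a choice
  \<open>K\<close> of classes and the saturated set \<open>\<Union>K\<close> carry the same information.
\<close>

lemma equiv_Restr_classes:
  assumes r: "equiv A r" and K: "K \<subseteq> A // r"
  shows "equiv (\<Union>K) (Restr r (\<Union>K))" and "\<Union>K // Restr r (\<Union>K) = K"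
proof -
  have sub: "\<Union>K \<subseteq> A" using K Union_quotient[OF r] by blast
  have sat: "c = r `` {x}" if "c \<in> K" "x \<in> c" for c x
    using that K quotientE r by (metis Image_singleton_iff equiv_class_eq subsetD)
  show "equiv (\<Union>K) (Restr r (\<Union>K))"
  proof (rule equivI)
    show "Restr r (\<Union>K) \<subseteq> \<Union>K \<times> \<Union>K" by blast
    show "refl_on (\<Union>K) (Restr r (\<Union>K))" "sym (Restr r (\<Union>K))"
      using r sub unfolding equiv_def refl_on_def sym_def by blast+
    show "trans (Restr r (\<Union>K))" using r unfolding equiv_def trans_def by blast
  qed
  have cl: "Restr r (\<Union>K) `` {x} = c" if "c \<in> K" "x \<in> c" for c x
    using sat[OF that] that by blast
  have ne: "c \<noteq> {}" if "c \<in> K" for c using that K r by (metis in_quotient_imp_non_empty subsetD)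
  show "\<Union>K // Restr r (\<Union>K) = K"
  proof (intro equalityI subsetI)
    fix c assume "c \<in> \<Union>K // Restr r (\<Union>K)"
    then show "c \<in> K" using cl by (auto elim!: quotientE)
  next
    fix c assume c: "c \<in> K"
    then obtain x where "x \<in> c" using ne by blast
    then show "c \<in> \<Union>K // Restr r (\<Union>K)" using cl[OF c] c unfolding quotient_def by blast
  qed
qed

definition component_rel :: "('v, 'd) dgraph \<Rightarrow> ('v \<times> 'v) set" where
  "component_rel G = Restr ({(x, y). {x, y} \<in> edges G}\<^sup>*) (verts G)"

lemma equiv_component_rel: "equiv (verts G) (component_rel G)"
proof (rule equivI)
  have "sym {(x, y). {x, y} \<in> edges G}" by (auto simp: sym_def insert_commute)
  then have "sym ({(x, y). {x, y} \<in> edges G}\<^sup>*)" by (rule sym_rtrancl)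
  then show "sym (component_rel G)" unfolding component_rel_def sym_def by blast
  show "trans (component_rel G)"
    unfolding component_rel_def by (rule transI) (blast intro: rtrancl_trans)
qed (auto simp: component_rel_def refl_on_def)

lemma component_relI: "{x, y} \<in> edges G \<Longrightarrow> x \<in> verts G \<Longrightarrow> y \<in> verts G \<Longrightarrow> (x, y) \<in> component_rel G"
  by (auto simp: component_rel_def)

lemma component_rel_connected:
  assumes G: "is_graph G"
  shows "component_rel G \<in> connected_equivs G"
  unfolding connected_equivs_def
proof (intro CollectI conjI ballI equiv_component_rel)
  fix c assume c: "c \<in> verts G // component_rel G"
  let ?E = "\<lambda>G :: ('a, 'b) dgraph. {(x, y). {x, y} \<in> edges G}"
  have cne: "c \<noteq> {}" using c equiv_component_rel by (metis in_quotient_imp_non_empty)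
  have "(x, y) \<in> (?E (induced G c))\<^sup>*" if "x \<in> c" "y \<in> c" for x y
  proof -
    have "(x, y) \<in> component_rel G"
      using that c equiv_component_rel in_quotient_imp_in_rel by fastforce
    then have "(x, y) \<in> (?E G)\<^sup>*" by (simp add: component_rel_def)
    then have "(x, y) \<in> (?E (induced G c))\<^sup>* \<and> y \<in> c"
    proof induction
      case base then show ?case using that by simp
    next
      case (step y z)
      then have "{y, z} \<in> edges G" by simp
      moreover from this have "(y, z) \<in> component_rel G"
        using G by (intro component_relI) (auto simp: is_graph_def)
      then have "z \<in> c" using in_quotient_imp_closed[OF equiv_component_rel c] step.IH by blast
      ultimately have "(y, z) \<in> ?E (induced G c)" using step.IH by (simp add: induced_def)
      with step.IH \<open>z \<in> c\<close> show ?case by (meson rtrancl.rtrancl_into_rtrancl)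
    qed
    then show ?thesis ..
  qed
  then show "connected_graph (induced G c)" using cne by (simp add: connected_graph_def)
qed

lemma component_rel_independent:
  assumes "is_graph G"
  shows "c \<in> verts G // component_rel G \<Longrightarrow> c' \<in> verts G // component_rel G \<Longrightarrow>
    x \<in> c \<Longrightarrow> y \<in> c' \<Longrightarrow> {x, y} \<in> edges G \<Longrightarrow> c = c'"
  using assms quotient_eqI[OF equiv_component_rel, of c G c' x y] component_relI[of x y G]
  by (auto simp: is_graph_def)

lemma edges_contract_iff:
  "{c, c'} \<in> edges (contract G r) \<longleftrightarrow>
    c \<in> verts G // r \<and> c' \<in> verts G // r \<and> c \<noteq> c' \<and> (\<exists>x\<in>c. \<exists>y\<in>c'. {x, y} \<in> edges G)"
  unfolding contract_def by (auto simp: doubleton_eq_iff) (metis insert_commute)+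

text \<open>
  A connected partition without edges between different classes is the partition into connected
  components: an edge cannot leave a class, and inside a class any two vertices are joined by a path.
\<close>

lemma component_rel_eqI:
  assumes G: "is_graph G" and r: "r \<in> connected_equivs G"
    and ind: "independent_set (contract G r) (verts G // r)"
  shows "component_rel G = r"
proof -
  have eq: "equiv (verts G) r" and conn: "\<And>c. c \<in> verts G // r \<Longrightarrow> connected_graph (induced G c)"
    using r by (auto simp: connected_equivs_def)
  let ?E = "\<lambda>G :: ('a, 'b) dgraph. {(x, y). {x, y} \<in> edges G}"
  have rsub: "r \<subseteq> verts G \<times> verts G" using eq by (auto simp: equiv_def refl_on_def)
  have edge: "(x, y) \<in> r" if e: "{x, y} \<in> edges G" for x y
  proof -
    have V: "x \<in> verts G" "y \<in> verts G" using e G by (auto simp: is_graph_def)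
    then have q: "r `` {x} \<in> verts G // r" "r `` {y} \<in> verts G // r" by (auto intro: quotientI)
    then have "{r `` {x}, r `` {y}} \<notin> edges (contract G r)" using ind by (simp add: independent_set_def)
    moreover have "x \<in> r `` {x}" "y \<in> r `` {y}" using equiv_class_self[OF eq] V by auto
    ultimately have "r `` {x} = r `` {y}" using q e unfolding edges_contract_iff by blast
    then show ?thesis using eq_equiv_class[OF _ eq] V by blast
  qed
  show ?thesis
  proof (intro equalityI subrelI)
    fix x y assume "(x, y) \<in> component_rel G"
    then have "(x, y) \<in> (?E G)\<^sup>*" "x \<in> verts G" by (auto simp: component_rel_def)
    then show "(x, y) \<in> r"
    proof induction
      case base then show ?case using eq by (auto simp: equiv_def refl_on_def)
    next
      case (step y z)
      then have "(x, y) \<in> r" "(y, z) \<in> r" using edge by auto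
      then show ?case using eq by (blast elim: equivE dest: transD)
    qed
  next
    fix x y assume xy: "(x, y) \<in> r"
    then have V: "x \<in> verts G" "y \<in> verts G" using rsub by auto
    have "x \<in> r `` {x}" "y \<in> r `` {x}" using equiv_class_self[OF eq] V xy by auto
    then have "(x, y) \<in> (?E (induced G (r `` {x})))\<^sup>*"
      using conn[OF quotientI[OF V(1)]] by (simp add: connected_graph_def)
    moreover have "?E (induced G (r `` {x})) \<subseteq> ?E G" by (auto simp: induced_def)
    ultimately have "(x, y) \<in> (?E G)\<^sup>*" using rtrancl_mono by blast
    then show "(x, y) \<in> component_rel G" using V by (simp add: component_rel_def)
  qed
qed

lemma connected_equivs_Un:
  assumes "r \<in> connected_equivs (induced G I)" "s \<in> connected_equivs (induced G J)"
    "I \<inter> J = {}" "verts G = I \<union> J"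
  shows "verts G // (r \<union> s) = I // r \<union> J // s" and "r \<union> s \<in> connected_equivs G"
proof -
  have eq: "equiv I r" "equiv J s" using assms(1,2) by (auto simp: connected_equivs_def)
  show q: "verts G // (r \<union> s) = I // r \<union> J // s"
    using equiv_Un_disjoint(2)[OF eq assms(3)] assms(4) by simp
  have "connected_graph (induced G c)" if c: "c \<in> verts G // (r \<union> s)" for c
  proof -
    consider "c \<in> I // r" "c \<subseteq> I" | "c \<in> J // s" "c \<subseteq> J"
      using c[unfolded q] in_quotient_imp_subset[OF eq(1)] in_quotient_imp_subset[OF eq(2)]
      by blast
    then show ?thesis using assms(1,2) by cases (auto simp: connected_equivs_def induced_induced)
  qed
  then show "r \<union> s \<in> connected_equivs G"
    using equiv_Un_disjoint(1)[OF eq assms(3)] assms(4) by (simp add: connected_equivs_def)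
qed

lemma connected_equivs_Restr:
  assumes r: "r \<in> connected_equivs G" and K: "K \<subseteq> verts G // r"
  shows "Restr r (\<Union>K) \<in> connected_equivs (induced G (\<Union>K))"
proof -
  have eq: "equiv (verts G) r" using r by (simp add: connected_equivs_def)
  then show ?thesis
    using equiv_Restr_classes[OF eq K] r K
    by (auto simp: connected_equivs_def induced_induced Union_upper)
qed

text \<open>
  Contraction commutes with passing to some of the classes. The decorations agree as well, because
  the decoration of a class only depends on the class and the decoration of \<open>G\<close>.
\<close>

lemma contract_induced:
  assumes r: "equiv I r" and sub: "I // r \<subseteq> verts G // s"
  shows "contract (induced G I) r = induced (contract G s) (I // r)"
proof -
  have "edges (contract (induced G I) r) = edges (induced (contract G s) (I // r))"
  proof (intro equalityI subsetI)
    fix e assume "e \<in> edges (contract (induced G I) r)"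
    then obtain c c' x y where "e = {c, c'}" "c \<in> I // r" "c' \<in> I // r" "c \<noteq> c'"
      "x \<in> c" "y \<in> c'" "{x, y} \<in> edges G" by (auto simp: contract_def induced_def)
    then show "e \<in> edges (induced (contract G s) (I // r))"
      using sub edges_contract_iff[of c c' G s] by (auto simp: induced_def)
  next
    fix e assume e: "e \<in> edges (induced (contract G s) (I // r))"
    then obtain c c' where cc: "e = {c, c'}" by (auto simp: contract_def induced_def)
    then have "c \<in> I // r" "c' \<in> I // r" "{c, c'} \<in> edges (contract G s)"
      using e by (auto simp: induced_def)
    moreover have "c \<subseteq> I" "c' \<subseteq> I" using calculation r by (metis in_quotient_imp_subset)+
    ultimately show "e \<in> edges (contract (induced G I) r)"
      unfolding cc edges_contract_iff by (auto simp: induced_def)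
  qed
  then show ?thesis by (simp add: contract_def induced_def)
qed

section \<open>The formula for the antipode\<close>

definition antipode_formula :: "('v, 'd::ab_semigroup_add) dgraph \<Rightarrow> 'd graph_alg" where
  "antipode_formula G = (\<Sum>r\<in>connected_equivs G.
     scale ((-1) ^ cl G r * of_nat (card (acyclic_orientations (contract G r))))
       (graph_vec (restrict_edges G r)))"

lemma finite_connected_equivs:
  assumes "is_graph G" shows "finite (connected_equivs G)"
proof (rule finite_subset)
  show "connected_equivs G \<subseteq> Pow (verts G \<times> verts G)"
    by (auto simp: connected_equivs_def equiv_def refl_on_def)
qed (use assms in \<open>simp add: is_graph_def\<close>)

lemma edges_restrict_edges_iff:
  "sym r \<Longrightarrow> {x, y} \<in> edges (restrict_edges G r) \<longleftrightarrow> {x, y} \<in> edges G \<and> (x, y) \<in> r"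
  by (auto simp: restrict_edges_def doubleton_eq_iff insert_commute dest: symD)

text \<open>
  The identity on vertices is an isomorphism: all edges inside \<open>J\<close> join vertices of the same
  component, and the edges between \<open>I\<close> and \<open>J\<close> are deleted on the right.
\<close>

lemma disjoint_union_restrict_edges:
  assumes r: "equiv I r" and V: "verts G = I \<union> J" "I \<inter> J = {}"
  shows "isomorphic (disjoint_union (restrict_edges (induced G I) r) (induced G J))
    (restrict_edges G (r \<union> component_rel (induced G J)))"
proof -
  let ?L = "disjoint_union (restrict_edges (induced G I) r) (induced G J)"
  let ?s = "component_rel (induced G J)"
  let ?R = "restrict_edges G (r \<union> ?s)"
  let ?f = "case_sum id id"
  have s: "equiv J ?s" using equiv_component_rel[of "induced G J"] by simp
  have rs: "r \<subseteq> I \<times> I" "?s \<subseteq> J \<times> J" using r s by (auto simp: equiv_def refl_on_def)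
  have sy: "sym r" "sym (r \<union> ?s)" using r s by (auto simp: equiv_def intro: sym_Un)
  have vL: "verts ?L = Inl ` I \<union> Inr ` J" by (simp add: disjoint_union_def restrict_edges_def)
  have vR: "verts ?R = I \<union> J" by (simp add: restrict_edges_def V)
  have eR: "{x, y} \<in> edges ?R \<longleftrightarrow> {x, y} \<in> edges G \<and> (x, y) \<in> r \<union> ?s" for x y
    by (rule edges_restrict_edges_iff[OF sy(2)])
  have II: "{x, y} \<in> edges (restrict_edges (induced G I) r) \<longleftrightarrow> {x, y} \<in> edges ?R"
    if "x \<in> I" "y \<in> I" for x y
    using that rs V(2) unfolding eR edges_restrict_edges_iff[OF sy(1)] by (auto simp: induced_def)
  have JJ: "{x, y} \<in> edges (induced G J) \<longleftrightarrow> {x, y} \<in> edges ?R" if "x \<in> J" "y \<in> J" for x y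
    using that component_relI[of x y "induced G J"] unfolding eR by (auto simp: induced_def)
  have IJ: "{x, y} \<notin> edges ?R" "{y, x} \<notin> edges ?R" if "x \<in> I" "y \<in> J" for x y
    using that rs V(2) unfolding eR by auto
  have "graph_iso ?f ?L ?R"
    unfolding graph_iso_def
  proof (intro conjI ballI)
    show "bij_betw ?f (verts ?L) (verts ?R)"
      unfolding vL vR
      by (rule bij_betw_byWitness[where f' = "\<lambda>x. if x \<in> I then Inl x else Inr x"])
         (use V(2) in auto)
  next
    fix x y assume "x \<in> verts ?L" "y \<in> verts ?L"
    then show "{x, y} \<in> edges ?L \<longleftrightarrow> {?f x, ?f y} \<in> edges ?R"
      unfolding vL by (elim UnE imageE) (simp_all add: edges_disjoint_union II JJ IJ)
  next
    fix x assume "x \<in> verts ?L"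
    then show "dec ?R (?f x) = dec ?L x"
      unfolding vL by (auto simp: disjoint_union_def restrict_edges_def induced_def)
  qed
  then show ?thesis unfolding isomorphic_def by blast
qed

text \<open>
  One direction of the correspondence between the pairs \<open>(I, r)\<close> with \<open>r \<triangleleft> G|I\<close> and the pairs
  \<open>(r', K)\<close> with \<open>r' \<triangleleft> G\<close> and \<open>K\<close> independent in \<open>G/r'\<close>: the components of the complement of \<open>I\<close>
  become the additional classes, which form \<open>K\<close>. The last two claims say that \<open>(I, r)\<close> is recovered
  from its image.
\<close>

lemma connected_equiv_extend:
  fixes G :: "('v, 'd::ab_semigroup_add) dgraph"
  assumes G: "is_graph G" and I: "I \<subseteq> verts G" and r: "r \<in> connected_equivs (induced G I)"
  defines "J \<equiv> verts G - I"
  defines "s \<equiv> component_rel (induced G J)"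
  shows "r \<union> s \<in> connected_equivs G"
    and "J // s \<subseteq> verts G // (r \<union> s)"
    and "verts G // (r \<union> s) - J // s = I // r"
    and "independent_set (contract G (r \<union> s)) (J // s)"
    and "verts G - \<Union>(J // s) = I"
    and "Restr (r \<union> s) I = r"
proof -
  have V: "I \<inter> J = {}" "verts G = I \<union> J" using I by (auto simp: J_def)
  have GJ: "is_graph (induced G J)" using G by (intro is_graph_induced) (auto simp: J_def)
  have eqr: "equiv I r" using r by (simp add: connected_equivs_def)
  have eqs: "equiv J s" using equiv_component_rel[of "induced G J"] by (simp add: s_def)
  note Un = connected_equivs_Un[OF r component_rel_connected[OF GJ] V, folded s_def]
  show "r \<union> s \<in> connected_equivs G" by (rule Un)
  show "J // s \<subseteq> verts G // (r \<union> s)" by (simp add: Un)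
  have "I // r \<inter> J // s = {}"
    using in_quotient_imp_subset[OF eqr] in_quotient_imp_subset[OF eqs]
      in_quotient_imp_non_empty[OF eqr] V(1) by blast
  then show "verts G // (r \<union> s) - J // s = I // r" by (auto simp: Un)
  show "independent_set (contract G (r \<union> s)) (J // s)"
    unfolding independent_set_def edges_contract_iff
  proof (intro ballI notI, elim conjE bexE)
    fix c c' x y
    assume c: "c \<in> J // s" "c' \<in> J // s" "c \<noteq> c'" and e: "x \<in> c" "y \<in> c'" "{x, y} \<in> edges G"
    then have "{x, y} \<in> edges (induced G J)"
      using in_quotient_imp_subset[OF eqs] by (auto simp: induced_def)
    then show False
      using component_rel_independent[OF GJ, of c c' x y] c e by (simp add: s_def)
  qed
  show "verts G - \<Union>(J // s) = I" using Union_quotient[OF eqs] V by auto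
  have "r \<subseteq> I \<times> I" "s \<subseteq> J \<times> J" using eqr eqs by (auto simp: equiv_def refl_on_def)
  then show "Restr (r \<union> s) I = r" using V(1) by blast
qed

text \<open>
  The inverse direction: remove the classes in \<open>K\<close>. As \<open>K\<close> is independent, its classes are the
  connected components of \<open>G\<close> on \<open>\<Union>K\<close> by \<open>component_rel_eqI\<close>, so that extending by these components
  restores \<open>r\<close> and \<open>K\<close>.
\<close>

lemma connected_equiv_split:
  fixes G :: "('v, 'd::ab_semigroup_add) dgraph"
  assumes G: "is_graph G" and r: "r \<in> connected_equivs G"
    and K: "K \<subseteq> verts G // r" and ind: "independent_set (contract G r) K"
  shows "Restr r (verts G - \<Union>K) \<in> connected_equivs (induced G (verts G - \<Union>K))"
    and "Restr r (verts G - \<Union>K) \<union> component_rel (induced G (\<Union>K)) = r"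
    and "\<Union>K // component_rel (induced G (\<Union>K)) = K"
    and "\<Union>K \<subseteq> verts G"
proof -
  have eq: "equiv (verts G) r" using r by (simp add: connected_equivs_def)
  have U: "\<Union>(verts G // r) = verts G" by (rule Union_quotient[OF eq])
  show sub: "\<Union>K \<subseteq> verts G" using K U by blast
  have I: "verts G - \<Union>K = \<Union>(verts G // r - K)"
  proof
    show "\<Union>(verts G // r - K) \<subseteq> verts G - \<Union>K"
    proof
      fix x assume "x \<in> \<Union>(verts G // r - K)"
      then obtain c where c: "c \<in> verts G // r" "c \<notin> K" "x \<in> c" by blast
      then have "c' = c" if "c' \<in> K" "x \<in> c'" for c'
        using that quotient_disj[OF eq c(1), of c'] K by blast
      then show "x \<in> verts G - \<Union>K" using c U by blast
    qed
  qed (use U in blast)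
  show "Restr r (verts G - \<Union>K) \<in> connected_equivs (induced G (verts G - \<Union>K))"
    unfolding I by (rule connected_equivs_Restr[OF r]) blast
  note eK = equiv_Restr_classes[OF eq K]
  have "contract (induced G (\<Union>K)) (Restr r (\<Union>K)) = induced (contract G r) K"
    using contract_induced[OF eK(1)] K unfolding eK(2) by metis
  then have "independent_set (contract (induced G (\<Union>K)) (Restr r (\<Union>K)))
      (verts (induced G (\<Union>K)) // Restr r (\<Union>K))"
    using ind by (simp add: eK(2)) (simp add: independent_set_def induced_def)
  then have comp: "component_rel (induced G (\<Union>K)) = Restr r (\<Union>K)"
    using is_graph_induced[OF G sub] connected_equivs_Restr[OF r K] by (intro component_rel_eqI)
  show "\<Union>K // component_rel (induced G (\<Union>K)) = K" unfolding comp by (rule eK)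
  have "(x, y) \<in> r \<Longrightarrow> x \<in> verts G \<and> y \<in> verts G \<and> (x \<in> \<Union>K \<longleftrightarrow> y \<in> \<Union>K)" for x y
  proof -
    assume xy: "(x, y) \<in> r"
    then have "x \<in> c \<longleftrightarrow> y \<in> c" if "c \<in> K" for c
      using in_quotient_imp_closed[OF eq, of c] that K symD[of r x y] eq
      by (auto simp: equiv_def)
    then show ?thesis using xy eq by (auto simp: equiv_def refl_on_def)
  qed
  then show "Restr r (verts G - \<Union>K) \<union> component_rel (induced G (\<Union>K)) = r"
    unfolding comp by (auto simp del: Union_iff)
qed

lemma scale_sum_left: "scale (\<Sum>i\<in>A. a i) x = (\<Sum>i\<in>A. scale (a i) x)"
  by (rule poly_mapping_eqI) (simp add: lookup_scale lookup_sum sum_distrib_right)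

text \<open>
  Expanding the products gives a sum over the pairs \<open>(I, r)\<close>. The reindexing by the pairs \<open>(r', K)\<close>
  collects the terms with the same graph \<open>G|r'\<close>, whose total coefficient is an alternating sum over
  the independent sets of \<open>G/r'\<close>. It vanishes unless \<open>G/r'\<close>, and hence \<open>G\<close>, is empty.
\<close>

lemma convolution_left_inverse_antipode_formula:
  "convolution_left_inverse (antipode_formula :: ('v, 'd::ab_semigroup_add) dgraph \<Rightarrow> 'd graph_alg)"
  unfolding convolution_left_inverse_def
proof (intro allI impI)
  fix G :: "('v, 'd) dgraph" assume G: "is_graph G"
  let ?V = "verts G" and ?ao = "\<lambda>H :: ('v set, 'd) dgraph. of_nat (card (acyclic_orientations H)) :: rat"
  let ?ind = "\<lambda>r. {K. K \<subseteq> ?V // r \<and> independent_set (contract G r) K}"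
  let ?w = "\<lambda>r K. (-1) ^ card (?V // r - K) * ?ao (induced (contract G r) (?V // r - K))"
  have fV: "finite ?V" using G by (simp add: is_graph_def)
  have fq: "finite (?V // r)" if "r \<in> connected_equivs G" for r
    using that fV by (auto simp: connected_equivs_def equiv_def refl_on_def intro: finite_quotient)
  have product: "antipode_formula (induced G I) \<star> graph_vec (induced G (?V - I)) =
      (\<Sum>r\<in>connected_equivs (induced G I).
        scale ((-1) ^ cl (induced G I) r * ?ao (contract (induced G I) r))
          (graph_vec (disjoint_union (restrict_edges (induced G I) r) (induced G (?V - I)))))"
    if "I \<subseteq> ?V" for I
    using is_graph_induced[OF G that] is_graph_induced[OF G, of "?V - I"]
    by (simp add: antipode_formula_def linear_map_sum[OF linear_map_times_left]
        linear_map_scale[OF linear_map_times_left] mult_graph_vec is_graph_restrict_edges)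
  have "(\<Sum>I\<in>Pow ?V. antipode_formula (induced G I) \<star> graph_vec (induced G (?V - I))) =
    (\<Sum>(I, r)\<in>(SIGMA I:Pow ?V. connected_equivs (induced G I)).
        scale ((-1) ^ cl (induced G I) r * ?ao (contract (induced G I) r))
          (graph_vec (disjoint_union (restrict_edges (induced G I) r) (induced G (?V - I)))))"
    using fV by (subst sum.Sigma[symmetric])
      (auto simp: product intro!: finite_connected_equivs is_graph_induced G)
  also have "\<dots> = (\<Sum>(r, K)\<in>(SIGMA r:connected_equivs G. ?ind r).
      scale (?w r K) (graph_vec (restrict_edges G r)))"
  proof (rule sum.reindex_bij_witness[where
        j = "\<lambda>(I, r). (r \<union> component_rel (induced G (?V - I)),
               (?V - I) // component_rel (induced G (?V - I)))" and
        i = "\<lambda>(r, K). (?V - \<Union>K, Restr r (?V - \<Union>K))"], goal_cases)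
    case (1 a)
    then obtain I r where a: "a = (I, r)" "I \<subseteq> ?V" "r \<in> connected_equivs (induced G I)" by auto
    show ?case using connected_equiv_extend(5,6)[OF G a(2,3)] by (simp add: a(1))
  next
    case (2 a)
    then obtain I r where a: "a = (I, r)" "I \<subseteq> ?V" "r \<in> connected_equivs (induced G I)" by auto
    show ?case using connected_equiv_extend(1,2,4)[OF G a(2,3)] by (simp add: a(1))
  next
    case (3 b)
    then obtain r K where b: "b = (r, K)" "r \<in> connected_equivs G" "K \<subseteq> ?V // r"
      "independent_set (contract G r) K" by auto
    note s = connected_equiv_split[OF G b(2-4)]
    show ?case using s(2,3) by (simp add: b(1) double_diff[OF s(4)])
  next
    case (4 b)
    then obtain r K where b: "b = (r, K)" "r \<in> connected_equivs G" "K \<subseteq> ?V // r"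
      "independent_set (contract G r) K" by auto
    show ?case using connected_equiv_split(1)[OF G b(2-4)] by (simp add: b(1))
  next
    case (5 a)
    then obtain I r where a: "a = (I, r)" "I \<subseteq> ?V" "r \<in> connected_equivs (induced G I)" by auto
    let ?s = "component_rel (induced G (?V - I))"
    have r: "equiv I r" using a(3) by (simp add: connected_equivs_def)
    note e = connected_equiv_extend[OF G a(2,3)]
    have "graph_vec (disjoint_union (restrict_edges (induced G I) r) (induced G (?V - I))) =
        graph_vec (restrict_edges G (r \<union> ?s))"
      using a(2) by (intro graph_vec_eqI disjoint_union_restrict_edges[OF r]
          is_graph_disjoint_union is_graph_restrict_edges is_graph_induced G) auto
    moreover have "contract (induced G I) r = induced (contract G (r \<union> ?s)) (I // r)"
      by (rule contract_induced[OF r]) (use e(3) in blast)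
    ultimately show ?case by (simp add: a(1) e(3) cl_def)
  qed
  also have "\<dots> = (\<Sum>r\<in>connected_equivs G. \<Sum>K\<in>?ind r. scale (?w r K) (graph_vec (restrict_edges G r)))"
    using fq by (intro sum.Sigma[symmetric] finite_connected_equivs G) (auto intro: finite_subset)
  also have "\<dots> = (\<Sum>r\<in>connected_equivs G. if ?V = {} then graph_vec (restrict_edges G r) else 0)"
  proof (intro sum.cong refl)
    fix r assume r: "r \<in> connected_equivs G"
    have eq: "equiv ?V r" using r by (simp add: connected_equivs_def)
    have "(\<Sum>K\<in>?ind r. ?w r K) = (-1) ^ card (?V // r) *
       (\<Sum>K\<in>?ind r. (-1) ^ card K * ?ao (induced (contract G r) (?V // r - K)))"
      unfolding sum_distrib_left
    proof (intro sum.cong refl)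
      fix K assume K: "K \<in> ?ind r"
      then have "card (?V // r) = card (?V // r - K) + card K"
        using fq[OF r] by (auto simp: card_Diff_subset finite_subset card_mono)
      then show "?w r K = (-1) ^ card (?V // r) * ((-1) ^ card K * ?ao (induced (contract G r) (?V // r - K)))"
        by (simp add: power_add)
    qed
    also have "\<dots> = (if ?V = {} then 1 else 0)"
      using alternating_sum_acyclic_orientations[OF is_graph_contract[OF G eq]]
      by (simp add: contract_def quotient_is_empty)
    finally show "(\<Sum>K\<in>?ind r. scale (?w r K) (graph_vec (restrict_edges G r))) =
        (if ?V = {} then graph_vec (restrict_edges G r) else 0)"
      by (simp add: scale_sum_left[symmetric]) (auto intro!: poly_mapping_eqI simp: lookup_scale)
  qed
  also have "\<dots> = (if ?V = {} then unit_elem else 0)"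
  proof (cases "?V = {}")
    case True
    then have "connected_equivs G = {{}}"
      by (auto simp: connected_equivs_def equiv_def refl_on_def sym_def trans_def)
    moreover have "graph_vec (restrict_edges G {}) = unit_elem"
      by (rule graph_vec_no_verts[OF is_graph_restrict_edges[OF G]]) (simp add: restrict_edges_def True)
    ultimately show ?thesis using True by simp
  qed simp
  finally show "(\<Sum>I\<in>Pow ?V. antipode_formula (induced G I) \<star> graph_vec (induced G (?V - I))) =
      (if ?V = {} then unit_elem else 0)" .
qed

theorem corollary2p18:
  fixes G :: "('v, 'd::ab_semigroup_add) dgraph"
  assumes "is_graph G"
  shows "antipode (graph_vec G) =
    (\<Sum>r \<in> connected_equivs G.
       scale ((-1) ^ cl G r * of_nat (card (acyclic_orientations (contract G r))))
         (graph_vec (restrict_edges G r)))"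
  using antipode_eq_left_inverse[OF convolution_left_inverse_antipode_formula
      convolution_left_inverse_antipode_formula assms]
  by (simp add: antipode_formula_def)

end
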